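(* Consider the system $\dot x=f(x,u,d)$, $y=h(x)$ with the sampled controller $u(t)=\kappa(y(t_k))$, $t\in[t_k,t_{k+1})$, $k\in\mathbb{N}$, and suppose that its impulsive form with state $x$ and sampling error $\varpi$ satisfies Assumption A (see context). Let $V_q,\gamma,\alpha_\varpi,\sigma_\varpi,\underline{\alpha}_q,\underline{\alpha}_\varpi$ be the functions described in the context. Let $\mathcal{X}\subset\mathbb{R}^n$ be a compact set and $$R_0=\max_{x\in\bar{\mathcal{X}}}\big\{\alpha_\varpi^{-1}\circ\sigma_\varpi\circ\underline{\alpha}_q^{-1}(V_q(x))\big\},$$ where $\bar{\mathcal{X}}$ is the closure of $\mathcal{X}$. Let the sampling be periodic, $t_{k+1}=t_k+T$ for all $k\in\mathbb{N}$, with a period $T>0$ such that $$2T\gamma(s)<\underline{\alpha}_\varpi(s),\qquad\forall\,0<s\le R_0.$$ Then the equilibrium point $x=0$ of the closed-loop system is asymptotically stable for any initial condition $x(t_0)\in\mathcal{X}$. Moreover, $\mathcal{X}\subseteq\mathbb{S}$, where $\mathbb{S}=\{x\mid V_q(x)\le\underline{\alpha}_q\circ\sigma_\varpi^{-1}\circ\alpha_\varpi(R_0)\}$ is positively invariant, and $\|\varpi(t)\|\le R_0$ for all $t\ge t_0$.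
   Context: System: $x\in\mathbb{R}^n$ is the state, $y\in\mathbb{R}^q$ the output, $u\in\mathbb{R}^m$ the input, and $d=d(t)\in\mathbb{R}^{n_d}$ is an uncertainty taking values in a compact set $\mathbb{D}$. The function $f$ is continuously differentiable with $f(0,0,d)=0$ for $d\in\mathbb D$; $h(0)=0$; $\kappa$ is continuously differentiable with $\kappa(0)=0$, and $\kappa\circ h$ is differentiable. The continuous-time feedback $u(t)=\kappa(y(t))$ is supposed to stabilize the equilibrium. Sampling error: $\varpi(t)=\kappa\circ h(x(t_k))-\kappa\circ h(x(t))$ for $t\in[t_k,t_{k+1})$. The closed-loop system has the impulsive form $\dot x=f_c(x,\varpi,d):=f(x,\kappa\circ h(x)+\varpi,d)$, $\dot\varpi=\psi(x,\varpi,d):=-\frac{\partial(\kappa\circ h)(x)}{\partial x}f_c(x,\varpi,d)$ for $t\in[t_k,t_{k+1})$, and $\varpi(t_k^+)=0$; initially $\varpi(t_0)=0$. Notation: $\mathbb{N}$ is the set of non-negative integers. For $\mathcal{K}_\infty$ functions, $\alpha'(s)=\mathcal{O}(\alpha(s))$ as $s\to0^+$ means $\limsup_{s\to0^+}\alpha'(s)/\alpha(s)<\infty$. For a continuously differentiable $V:\mathbb{R}^n\to\mathbb{R}_{\ge0}$, $V(x)\sim\{\underline{\alpha},\bar\alpha,\alpha,\sigma\mid\dot x=f_c(x,\varpi,d)\}$ ("ISS-Lyapunov function") means $\underline{\alpha},\bar\alpha,\alpha,\sigma\in\mathcal{K}_\infty$ and, for all $x\in\mathbb{R}^n,\varpi\in\mathbb{R}^m,d\in\mathbb{D}$,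 $\underline{\alpha}(\|x\|)\le V(x)\le\bar\alpha(\|x\|)$ and, along $\dot x=f_c(x,\varpi,d)$, $\dot V(x)\le-\alpha(\|x\|)+\sigma(\|\varpi\|)$. Assumption A: The $x$-subsystem has an ISS-Lyapunov function $V(x)\sim\{\underline{\alpha},\bar\alpha,\alpha,\sigma\mid\dot x=f_c(x,\varpi,d)\}$. There exists a continuously differentiable $U:\mathbb{R}^m\to\mathbb{R}_{\ge0}$ such that, for all $x\in\mathbb{R}^n,\varpi\in\mathbb{R}^m,d\in\mathbb{D}$, $\underline{\alpha}_\varpi(\|\varpi\|)\le U(\varpi)\le\bar\alpha_\varpi(\|\varpi\|)$ and $\dot U(\varpi)=\big(\frac{\partial U(\varpi)}{\partial\varpi}\big)^{T}\psi(x,\varpi,d)\le\alpha_\varpi(\|\varpi\|)+\sigma_\varpi(\|x\|)$ for some $\underline{\alpha}_\varpi,\bar\alpha_\varpi,\alpha_\varpi,\sigma_\varpi\in\mathcal{K}_\infty$. Functions used: $\underline{\alpha}_\varpi,\alpha_\varpi,\sigma_\varpi$ are those of Assumption A, with $\sigma_\varpi(s)=\mathcal{O}(\alpha(s))$ as $s\to0^+$. $\alpha_q\in\mathcal{K}_\infty$ satisfies $\alpha_q(s)>2\sigma_\varpi(s)$ for $s>0$ and $\alpha_q(s)=\mathcal{O}(\alpha(s))$ as $s\to0^+$; $V_q(x)\sim\{\underline{\alpha}_q,\bar\alpha_q,\alpha_q,\sigma_q\mid\dot x=f_c(x,\varpi,d)\}$ is an associated ISS-Lyapunov function with $\underline{\alpha}_q,\bar\alpha_q,\sigma_q\in\mathcal{K}_\infty$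 (it exists by the changing-supply-function technique applied to $V$). $\hat\alpha_\varpi,\gamma\in\mathcal{K}_\infty$ satisfy $\hat\alpha_\varpi(s)>\sigma_q(s)/2$ and $\gamma(s)>\hat\alpha_\varpi(s)+\alpha_\varpi(s)$ for $s>0$, and $\gamma(s)=\mathcal{O}(\underline{\alpha}_\varpi(s))$ as $s\to0^+$. Positive invariance of $\mathbb{S}$ refers to the $x$-trajectories of the sampled closed-loop system started at $t_0$ with $\varpi(t_0)=0$. *)

theory Defs
  imports "HOL-Analysis.Analysis"
begin

definition K_infinity :: "(real \<Rightarrow> real) \<Rightarrow> bool" where
  "K_infinity a \<longleftrightarrow>
     continuous_on {0..} a \<and> strict_mono_on {0..} a \<and> a 0 = 0 \<and> filterlim a at_top at_top"

text \<open>A function of class K-infinity is only meaningful on \<open>{0..}\<close>, so its inverse is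
  \<open>inv_into {0..} a\<close>, not \<open>inv a\<close>.\<close>

abbreviation K_inv :: "(real \<Rightarrow> real) \<Rightarrow> real \<Rightarrow> real" where
  "K_inv a \<equiv> inv_into {0..} a"

definition O_at_zero :: "(real \<Rightarrow> real) \<Rightarrow> (real \<Rightarrow> real) \<Rightarrow> bool" where
  "O_at_zero a' a \<longleftrightarrow> Limsup (at_right 0) (\<lambda>s. ereal (a' s / a s)) < \<infinity>"

definition cont_differentiable ::
    "('a::real_normed_vector \<Rightarrow> 'b::real_normed_vector) \<Rightarrow> bool" where
  "cont_differentiable F \<longleftrightarrow>
     (\<exists>F' :: 'a \<Rightarrow> 'a \<Rightarrow>\<^sub>L 'b.
        (\<forall>x. (F has_derivative blinfun_apply (F' x)) (at x)) \<and> continuous_on UNIV F')"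

definition f_closed ::
    "(real^'n \<Rightarrow> real^'m \<Rightarrow> real^'e \<Rightarrow> real^'n) \<Rightarrow> (real^'n \<Rightarrow> real^'q) \<Rightarrow> (real^'q \<Rightarrow> real^'m)
      \<Rightarrow> real^'n \<Rightarrow> real^'m \<Rightarrow> real^'e \<Rightarrow> real^'n" where
  "f_closed f h \<kappa> x w d = f x ((\<kappa> \<circ> h) x + w) d"

definition psi_closed ::
    "(real^'n \<Rightarrow> real^'m \<Rightarrow> real^'e \<Rightarrow> real^'n) \<Rightarrow> (real^'n \<Rightarrow> real^'q) \<Rightarrow> (real^'q \<Rightarrow> real^'m)
      \<Rightarrow> real^'n \<Rightarrow> real^'m \<Rightarrow> real^'e \<Rightarrow> real^'m" where
  "psi_closed f h \<kappa> x w d = - frechet_derivative (\<kappa> \<circ> h) (at x) (f_closed f h \<kappa> x w d)"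

text \<open>\<open>iss_lyapunov D F V al au a s\<close> is \<open>V \<sim> {al, au, a, s | x' = F x w d}\<close>.\<close>

definition iss_lyapunov ::
    "(real^'e) set \<Rightarrow> (real^'n \<Rightarrow> real^'m \<Rightarrow> real^'e \<Rightarrow> real^'n) \<Rightarrow> (real^'n \<Rightarrow> real)
      \<Rightarrow> (real \<Rightarrow> real) \<Rightarrow> (real \<Rightarrow> real) \<Rightarrow> (real \<Rightarrow> real) \<Rightarrow> (real \<Rightarrow> real) \<Rightarrow> bool" where
  "iss_lyapunov D F V al au a s \<longleftrightarrow>
     cont_differentiable V \<and>
     K_infinity al \<and> K_infinity au \<and> K_infinity a \<and> K_infinity s \<and>
     (\<forall>x. al (norm x) \<le> V x \<and> V x \<le> au (norm x)) \<and>
     (\<forall>x w. \<forall>d\<in>D. frechet_derivative V (at x) (F x w d) \<le> - a (norm x) + s (norm w))"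

text \<open>The condition on the sampling error subsystem \<open>w' = P x w d\<close>: the bound \<open>a\<close> enters
  with a positive sign, so \<open>U\<close> may grow between sampling instants.\<close>

definition error_growth ::
    "(real^'e) set \<Rightarrow> (real^'n \<Rightarrow> real^'m \<Rightarrow> real^'e \<Rightarrow> real^'m) \<Rightarrow> (real^'m \<Rightarrow> real)
      \<Rightarrow> (real \<Rightarrow> real) \<Rightarrow> (real \<Rightarrow> real) \<Rightarrow> (real \<Rightarrow> real) \<Rightarrow> (real \<Rightarrow> real) \<Rightarrow> bool" where
  "error_growth D P U al au a s \<longleftrightarrow>
     cont_differentiable U \<and>
     K_infinity al \<and> K_infinity au \<and> K_infinity a \<and> K_infinity s \<and>
     (\<forall>w. al (norm w) \<le> U w \<and> U w \<le> au (norm w)) \<and>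
     (\<forall>x w. \<forall>d\<in>D. frechet_derivative U (at w) (P x w d) \<le> a (norm w) + s (norm x))"

definition uncertainty :: "(real^'e) set \<Rightarrow> real \<Rightarrow> (real \<Rightarrow> real^'e) \<Rightarrow> bool" where
  "uncertainty D t0 d \<longleftrightarrow>
     d \<in> borel_measurable (lebesgue_on {t0..}) \<and> (\<forall>s\<ge>t0. d s \<in> D)"

text \<open>Caratheodory solutions, in integral form, of \<open>x' = f x u d\<close>, \<open>y = h x\<close> under the sampled
  controller \<open>u = \<kappa> (y (t k))\<close> on \<open>[t k, t (k+1))\<close>, over the interval \<open>[t 0, b)\<close>; only measurability
  of \<open>d\<close> is assumed, so the differential equation holds almost everywhere. Finite \<open>b\<close> is allowed
  so that statements about solutions are not vacuous for solutions escaping in finite time.\<close>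

definition sampled_solution ::
    "(real^'n \<Rightarrow> real^'m \<Rightarrow> real^'e \<Rightarrow> real^'n) \<Rightarrow> (real^'n \<Rightarrow> real^'q) \<Rightarrow> (real^'q \<Rightarrow> real^'m)
      \<Rightarrow> (nat \<Rightarrow> real) \<Rightarrow> (real \<Rightarrow> real^'e) \<Rightarrow> ereal \<Rightarrow> (real \<Rightarrow> real^'n) \<Rightarrow> bool" where
  "sampled_solution f h \<kappa> t d b x \<longleftrightarrow>
     (\<forall>k s. t k \<le> s \<and> s \<le> t (Suc k) \<and> ereal s < b \<longrightarrow>
        ((\<lambda>r. f (x r) (\<kappa> (h (x (t k)))) (d r)) has_integral (x s - x (t k))) {t k..s})"

definition sampling_error ::
    "(real^'n \<Rightarrow> real^'q) \<Rightarrow> (real^'q \<Rightarrow> real^'m) \<Rightarrow> (nat \<Rightarrow> real) \<Rightarrow> (real \<Rightarrow> real^'n)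
      \<Rightarrow> real \<Rightarrow> real^'m" where
  "sampling_error h \<kappa> t x s =
     (\<kappa> \<circ> h) (x (t (THE k. s \<in> {t k..<t (Suc k)}))) - (\<kappa> \<circ> h) (x s)"

definition positively_invariant ::
    "(real^'n \<Rightarrow> real^'m \<Rightarrow> real^'e \<Rightarrow> real^'n) \<Rightarrow> (real^'n \<Rightarrow> real^'q) \<Rightarrow> (real^'q \<Rightarrow> real^'m)
      \<Rightarrow> (real^'e) set \<Rightarrow> (nat \<Rightarrow> real) \<Rightarrow> (real^'n) set \<Rightarrow> bool" where
  "positively_invariant f h \<kappa> D t S \<longleftrightarrow>
     (\<forall>d b x. uncertainty D (t 0) d \<and> sampled_solution f h \<kappa> t d b x \<and> x (t 0) \<in> S \<longrightarrow>
        (\<forall>s\<ge>t 0. ereal s < b \<longrightarrow> x s \<in> S))"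

text \<open>Asymptotic stability of the origin for initial states in \<open>M\<close>: solutions from \<open>M\<close> exist for
  all time, they stay near the origin if they start near it (uniformly in the uncertainty), and
  they converge to it. With \<open>M\<close> a neighbourhood of the origin this is the usual local notion.\<close>

definition asymptotically_stable_from ::
    "(real^'n \<Rightarrow> real^'m \<Rightarrow> real^'e \<Rightarrow> real^'n) \<Rightarrow> (real^'n \<Rightarrow> real^'q) \<Rightarrow> (real^'q \<Rightarrow> real^'m)
      \<Rightarrow> (real^'e) set \<Rightarrow> (nat \<Rightarrow> real) \<Rightarrow> (real^'n) set \<Rightarrow> bool" where
  "asymptotically_stable_from f h \<kappa> D t M \<longleftrightarrow>
     (\<forall>d. uncertainty D (t 0) d \<longrightarrow>
        (\<forall>x0\<in>M. \<exists>x. x (t 0) = x0 \<and> sampled_solution f h \<kappa> t d \<infinity> x)) \<and>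
     (\<forall>\<epsilon>>0. \<exists>\<delta>>0. \<forall>d b x.
        uncertainty D (t 0) d \<and> sampled_solution f h \<kappa> t d b x \<and> x (t 0) \<in> M \<and>
        norm (x (t 0)) < \<delta> \<longrightarrow> (\<forall>s\<ge>t 0. ereal s < b \<longrightarrow> norm (x s) < \<epsilon>)) \<and>
     (\<forall>d x. uncertainty D (t 0) d \<and> sampled_solution f h \<kappa> t d \<infinity> x \<and> x (t 0) \<in> M \<longrightarrow>
        (x \<longlongrightarrow> 0) at_top)"

end

theory Submission
  imports Defs
begin

text \<open>On a sampling interval starting at \<open>a\<close> put \<open>v = V_q (x s)\<close> and \<open>p = U (w s)\<close>, so that
  \<open>p = 0\<close> at \<open>a\<close>. Then \<open>v' \<le> - \<alpha>_q |x| + \<sigma>_q |w|\<close> and \<open>(v + 2 p)' \<le> 2 \<gamma> |w|\<close>. If \<open>m\<close> is the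
  largest error up to time \<open>s\<close>, this gives \<open>v s \<le> v a + 2 T \<gamma> m - 2 al_w m \<le> v a - al_w m\<close> as long as
  \<open>m \<le> R0\<close>. Hence \<open>v\<close> stays below its value at \<open>a\<close>; this bounds \<open>\<sigma>_w |x|\<close> by \<open>\<alpha>_w R0\<close>, so
  \<open>p \<le> 2 T \<alpha>_w R0 < al_w R0\<close> and the error never reaches \<open>R0\<close>. The values of \<open>v\<close> at the sampling
  instants decrease, and if their limit were positive, the errors would tend to zero while \<open>|x|\<close>
  stays away from zero, so \<open>v\<close> would drop by a fixed amount over every late interval.\<close>

section \<open>Differential inequalities along integral curves\<close>

text \<open>The weight 2 in \<open>V_q + 2 U\<close> fits both couplings:
  \<open>\<alpha>_q > 2 \<sigma>_w\<close> lets the decay of \<open>V_q\<close> absorb the state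
  term in the growth of U, and \<open>2 \<gamma>\<close> dominates
  \<open>\<sigma>_q + 2 \<alpha>_w\<close>. At the time of the largest error, U has gained at least
  \<open>al_w m\<close>; this counts twice, the period condition consumes it once, and the rest is
  the decrease. The estimate is circular: the decrease needs an error of at most R0, and the error
  bound needs the decrease. Strictness of the period condition permits a first-exit argument. Within
  an interval \<open>V_q\<close> may rise and fall, so only comparisons with the preceding sample
  are available. Global existence is part of the claim although f is only locally Lipschitz;
  invariance of S supplies the missing a priori bound. R0 = 0 occurs only for X = {0}; the period is
  then unrestricted and the barrier at R0 degenerates.\<close>

text \<open>The map \<open>\<kappa> \<circ> h\<close> is only assumed differentiable, so the sampling error along a solution need
  not be absolutely continuous and cannot be recovered by integrating its derivative. What remains
  is that its difference quotients are bounded at every time and have the right limit at almost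
  every time; the exceptional null set is absorbed by a monotone function of small total variation
  whose right derivative is infinite on that set.\<close>

lemma negligible_steep_function:
  assumes "negligible (N :: real set)" "e > 0"
  obtains \<Phi> :: "real \<Rightarrow> real" where "mono \<Phi>" "\<And>a b. \<Phi> b - \<Phi> a \<le> e"
    "\<And>t C. t \<in> N \<Longrightarrow> \<forall>\<^sub>F s in at_right t. C * (s - t) \<le> \<Phi> s - \<Phi> t"
proof -
  have "\<exists>W. open W \<and> N \<subseteq> W \<and> W \<in> lmeasurable \<and> measure lebesgue W \<le> e / (real n + 1) / 2 ^ Suc n" for n :: nat
  proof -
    let ?d = "e / (real n + 1) / 2 ^ Suc n"
    have d: "?d > 0" using \<open>e > 0\<close> by simp
    obtain W where W: "open W" "N \<subseteq> W" "W - N \<in> lmeasurable" "emeasure lebesgue (W - N) < ennreal ?d"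
      using sets_lebesgue_outer_open[OF negligible_imp_sets[OF assms(1)] d] by blast
    have "W = (W - N) \<union> N" using W by auto
    moreover have "(W - N) \<union> N \<in> lmeasurable"
      by (intro fmeasurable.Un W(3) negligible_imp_measurable assms(1))
    moreover have "measure lebesgue ((W - N) \<union> N) = measure lebesgue (W - N)"
      using W(3) assms(1)
      by (intro measure_Un_null_set) (auto simp: negligible_iff_null_sets)
    moreover have "measure lebesgue (W - N) \<le> ?d"
      using W(3,4) d by (simp add: emeasure_eq_measure2 ennreal_less_iff)
    ultimately show ?thesis using W(1,2) by metis
  qed
  then obtain W where W: "\<And>n. open (W n)" "\<And>n. N \<subseteq> W n" "\<And>n. W n \<in> lmeasurable"
      "\<And>n. measure lebesgue (W n) \<le> e / (real n + 1) / 2 ^ Suc n"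
    by metis
  \<comment> \<open>The factor \<open>real n\<close> gives slope at least n just to the right of
    every point of N; the bound on the measure of \<open>W n\<close> keeps the n-th term below
    \<open>e / 2 ^ Suc n\<close>, so the series stays below e.\<close>
  define \<phi> where "\<phi> s n = real n * measure lebesgue (W n \<inter> {..s})" for s and n :: nat
  define \<Phi> where "\<Phi> s = suminf (\<phi> s)" for s
  have meas: "W n \<inter> {..s} \<in> lmeasurable" for n s
    using W(3) by (simp add: fmeasurable_Int_fmeasurable)
  have pos: "0 \<le> \<phi> s n" for s n by (simp add: \<phi>_def)
  have ub: "\<phi> s n \<le> e * (1/2) ^ Suc n" for s n
  proof -
    have "measure lebesgue (W n \<inter> {..s}) \<le> e / (real n + 1) / 2 ^ Suc n"
      using W(3,4)[of n] measure_mono_fmeasurable[of "W n \<inter> {..s}" "W n" lebesgue] meas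
      by (meson Int_lower1 fmeasurableD order_trans)
    then have "\<phi> s n \<le> real n * (e / (real n + 1) / 2 ^ Suc n)"
      unfolding \<phi>_def by (rule mult_left_mono) simp
    also have "\<dots> = (real n / (real n + 1)) * (e / 2 ^ Suc n)" by simp
    also have "\<dots> \<le> 1 * (e / 2 ^ Suc n)"
      using \<open>e > 0\<close> by (intro mult_right_mono) auto
    finally show ?thesis by (simp add: power_divide)
  qed
  have sume: "(\<lambda>n. e * (1/2) ^ Suc n) sums e"
    using sums_mult[OF power_half_series, of e] by simp
  have summ: "summable (\<phi> s)" for s
    by (rule summable_comparison_test'[OF sums_summable[OF sume], of 0]) (use pos ub in auto)
  have mono_phi: "\<phi> t n \<le> \<phi> s n" if "t \<le> s" for s t n
    unfolding \<phi>_def using that meas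
    by (intro mult_left_mono measure_mono_fmeasurable) (auto simp: fmeasurableD)
  show thesis
  proof
    show "mono \<Phi>"
      by (intro monoI) (simp add: \<Phi>_def mono_phi suminf_le summ)
    show "\<Phi> b - \<Phi> a \<le> e" for a b
    proof -
      have "\<Phi> b \<le> e"
        unfolding \<Phi>_def using suminf_le[OF ub summ sums_summable[OF sume]] sums_unique[OF sume] by metis
      moreover have "0 \<le> \<Phi> a" unfolding \<Phi>_def by (intro suminf_nonneg summ pos)
      ultimately show ?thesis by simp
    qed
    fix t C assume "t \<in> N"
    obtain n :: nat where n: "C \<le> real n" using real_arch_simple by blast
    obtain d where d: "d > 0" "ball t d \<subseteq> W n"
      using W(1,2) \<open>t \<in> N\<close> by (meson openE subsetD)
    have "C * (s - t) \<le> \<Phi> s - \<Phi> t" if s: "t < s" "s < t + d" for s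
    proof -
      have sub: "(W n \<inter> {..t}) \<union> {t<..s} \<subseteq> W n \<inter> {..s}"
        using s d(2) by (auto simp: subset_iff dist_real_def)
      have "measure lebesgue (W n \<inter> {..t}) + measure lebesgue {t<..s}
            = measure lebesgue ((W n \<inter> {..t}) \<union> {t<..s})"
        by (rule measure_Un_AE[symmetric]) (auto simp: meas bounded_set_imp_lmeasurable)
      also have "\<dots> \<le> measure lebesgue (W n \<inter> {..s})"
        using sub meas by (intro measure_mono_fmeasurable) (auto simp: fmeasurableD)
      finally have "s - t \<le> measure lebesgue (W n \<inter> {..s}) - measure lebesgue (W n \<inter> {..t})"
        using s by simp
      then have "real n * (s - t) \<le> \<phi> s n - \<phi> t n"
        unfolding \<phi>_def right_diff_distrib[symmetric] by (intro mult_left_mono) auto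
      also have "\<dots> \<le> (\<Sum>k. \<phi> s k - \<phi> t k)"
        using sum_le_suminf[of "\<lambda>k. \<phi> s k - \<phi> t k" "{n}"] mono_phi[of t s] s
        by (simp add: summable_diff summ)
      also have "\<dots> = \<Phi> s - \<Phi> t" by (simp add: \<Phi>_def suminf_diff summ)
      finally show ?thesis using n s by (smt (verit) mult_right_mono)
    qed
    then show "\<forall>\<^sub>F s in at_right t. C * (s - t) \<le> \<Phi> s - \<Phi> t"
      using d(1) by (intro eventually_at_rightI[of t "t + d"]) auto
  qed
qed

text \<open>A bound almost everywhere alone would admit the Cantor function; finiteness of the
  quotients at every point excludes it. The proof is continuous induction: the supremum of the times
  up to which g, tilted by \<open>M + e\<close>, stays below \<open>\<Phi>\<close> must be
  b.\<close>

lemma increment_le_of_right_quotients: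
  fixes g :: "real \<Rightarrow> real"
  assumes ab: "a \<le> b" and cont: "continuous_on {a..b} g" and N: "negligible N"
    and fin: "\<And>t. t \<in> {a..<b} \<Longrightarrow> \<exists>C. \<forall>\<^sub>F s in at_right t. g s - g t \<le> C * (s - t)"
    and ae: "\<And>t e. t \<in> {a..<b} - N \<Longrightarrow> e > 0 \<Longrightarrow> \<forall>\<^sub>F s in at_right t. g s - g t \<le> (M + e) * (s - t)"
  shows "g b - g a \<le> M * (b - a)"
proof -
  \<comment> \<open>The slack has two sources: \<open>e * (b - a)\<close> from the raised slope
    \<open>M + e\<close>, and e from the total variation of \<open>\<Phi>\<close>.\<close>
  have *: "g b - g a \<le> M * (b - a) + e * (b - a + 1)" if e: "e > 0" for e
  proof -
    obtain \<Phi> :: "real \<Rightarrow> real" where \<Phi>: "mono \<Phi>" "\<And>a b. \<Phi> b - \<Phi> a \<le> e"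
      "\<And>t C. t \<in> N \<Longrightarrow> \<forall>\<^sub>F s in at_right t. C * (s - t) \<le> \<Phi> s - \<Phi> t"
      using negligible_steep_function[OF N e] by metis
    define G where "G t = g t - (M + e) * t" for t
    have contG: "continuous_on {a..b} G"
      unfolding G_def by (intro continuous_intros cont)
    define A where "A = {t \<in> {a..b}. G t \<le> G a + \<Phi> t - \<Phi> a}"
    define c where "c = Sup A"
    have aA: "a \<in> A" using ab by (simp add: A_def)
    have bdd: "bdd_above A" by (rule bdd_aboveI[of _ b]) (auto simp: A_def)
    have ac: "a \<le> c" unfolding c_def by (rule cSup_upper[OF aA bdd])
    have cb: "c \<le> b" unfolding c_def by (rule cSup_least) (use aA in \<open>auto simp: A_def\<close>)
    \<comment> \<open>Only monotonicity of \<open>\<Phi>\<close> is at hand, so A is not known to be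
      closed. Freezing \<open>\<Phi>\<close> at its value in c gives a closed superset, which must
      contain the supremum.\<close>
    define B where "B = {t \<in> {a..b}. G t \<le> G a + \<Phi> c - \<Phi> a}"
    have "closed B"
    proof -
      have "closed ({a..b} \<inter> G -` {..G a + \<Phi> c - \<Phi> a})"
        by (rule continuous_closed_preimage[OF contG]) auto
      moreover have "{a..b} \<inter> G -` {..G a + \<Phi> c - \<Phi> a} = B" by (auto simp: B_def)
      ultimately show ?thesis by simp
    qed
    moreover have "A \<subseteq> B"
    proof
      fix t assume t: "t \<in> A"
      then have "\<Phi> t \<le> \<Phi> c" using \<Phi>(1) bdd by (simp add: c_def cSup_upper monoD)
      then show "t \<in> B" using t by (auto simp: A_def B_def)
    qed
    ultimately have "c \<in> B"
      using closed_subset_contains_Sup[of B A] aA bdd unfolding c_def by auto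
    then have cA: "G c \<le> G a + \<Phi> c - \<Phi> a" by (simp add: B_def)
    have "c = b"
    proof (rule ccontr)
      assume "c \<noteq> b"
      then have c: "c \<in> {a..<b}" using ac cb by auto
      have "\<forall>\<^sub>F s in at_right c. G s - G c \<le> \<Phi> s - \<Phi> c"
      proof (cases "c \<in> N")
        \<comment> \<open>Here \<open>\<Phi>\<close> outgrows every linear rate, so any finite C
          will do; off N the slack e in the slope carries the argument past c.\<close>
        case True
        obtain C where C: "\<forall>\<^sub>F s in at_right c. g s - g c \<le> C * (s - c)" using fin c by blast
        show ?thesis using C \<Phi>(3)[OF True, of "C - (M + e)"]
          by eventually_elim (simp add: G_def algebra_simps)
      next
        case False
        have "\<forall>\<^sub>F s in at_right c. g s - g c \<le> (M + e) * (s - c)" using ae c False e by blast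
        moreover have "\<forall>\<^sub>F s in at_right c. s > c" by (simp add: eventually_at_right_less)
        ultimately show ?thesis
        proof eventually_elim
          case (elim s)
          then have "\<Phi> c \<le> \<Phi> s" using \<Phi>(1) by (simp add: monoD)
          then show ?case using elim by (simp add: G_def algebra_simps)
        qed
      qed
      moreover have "\<forall>\<^sub>F s in at_right c. s \<in> {c<..<b}"
        using c by (intro eventually_at_rightI[of c b]) auto
      ultimately have "\<forall>\<^sub>F s in at_right c. G s - G c \<le> \<Phi> s - \<Phi> c \<and> s \<in> {c<..<b}"
        by eventually_elim simp
      then obtain s where s: "G s - G c \<le> \<Phi> s - \<Phi> c" "s \<in> {c<..<b}"
        using eventually_happens' trivial_limit_at_right_real by blast
      then have "s \<in> A" using cA ac by (auto simp: A_def)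
      then have "s \<le> c" unfolding c_def using bdd by (rule cSup_upper)
      then show False using s by simp
    qed
    with cA have "G b \<le> G a + \<Phi> b - \<Phi> a" by simp
    then have "g b - g a \<le> (M + e) * (b - a) + e"
      using \<Phi>(2)[of b a] by (simp add: G_def algebra_simps)
    then show ?thesis by (simp add: algebra_simps)
  qed
  show ?thesis
  proof (rule field_le_epsilon)
    fix e :: real assume "e > 0"
    then have "e / (b - a + 1) > 0" using ab by simp
    from *[OF this] show "g b - g a \<le> M * (b - a) + e" using ab by simp
  qed
qed

text \<open>The bound L makes x Lipschitz, which with differentiability of F bounds the right
  quotients of \<open>F \<circ> x\<close> at every time. Where the right averages of g converge to
  g, x has right derivative g, and the chain rule gives the bound M; by Lebesgue differentiation
  this fails only on a null set.\<close>

lemma increment_along_integral_curve: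
  fixes F :: "'a::euclidean_space \<Rightarrow> real" and x g :: "real \<Rightarrow> 'a"
  assumes ab: "a \<le> b"
    and int: "\<And>s. s \<in> {a..b} \<Longrightarrow> (g has_integral (x s - x a)) {a..s}"
    and L: "\<And>s. s \<in> {a..b} \<Longrightarrow> norm (g s) \<le> L"
    and F: "\<And>s. s \<in> {a..b} \<Longrightarrow> F differentiable at (x s)"
    and M: "\<And>s. s \<in> {a..b} \<Longrightarrow> frechet_derivative F (at (x s)) (g s) \<le> M"
  shows "F (x b) - F (x a) \<le> M * (b - a)"
proof -
  \<comment> \<open>Extension by zero makes the function integrable on every box, as the
    differentiation theorem requires.\<close>
  define G where "G r = (if r \<in> {a..b} then g r else 0)" for r
  have "g integrable_on {a..b}" using int[of b] ab by auto
  then have "G integrable_on UNIV" unfolding G_def by (simp only: integrable_restrict_UNIV)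
  then have "G integrable_on cbox c d" for c d by (rule integrable_on_subcbox) auto
  from integrable_ccontinuous_explicit[OF this] obtain N where N: "negligible N"
    "\<And>t e. \<lbrakk>t \<notin> N; 0 < e\<rbrakk> \<Longrightarrow> \<exists>d>0. \<forall>h. 0 < h \<and> h < d \<longrightarrow>
        norm (integral (cbox t (t + h *\<^sub>R One)) G /\<^sub>R h ^ DIM(real) - G t) < e"
    by blast
  have incr: "(g has_integral (x s - x t)) {t..s}" if "a \<le> t" "t \<le> s" "s \<le> b" for s t
  proof -
    have "g integrable_on {a..s}" using int[of s] that by auto
    then have "g integrable_on {t..s}" using that by (auto intro: integrable_on_subinterval)
    moreover from this have "(g has_integral (x t - x a) + integral {t..s} g) {a..s}"
      using that int[of t] by (intro has_integral_combine[of a t s]) (auto simp: integrable_integral)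
    then have "x s - x a = (x t - x a) + integral {t..s} g"
      using has_integral_unique[OF int[of s]] that by simp
    ultimately show ?thesis by (simp add: has_integral_iff algebra_simps)
  qed
  have L0: "0 \<le> L" using order_trans[OF norm_ge_zero L[of a]] ab by simp
  have lip: "norm (x s - x t) \<le> L * (s - t)" if "a \<le> t" "t \<le> s" "s \<le> b" for s t
    using has_integral_bound[OF L0, of g "x s - x t" t s] incr[OF that] L that by simp
  have contx: "continuous_on {a..b} x"
  proof -
    have "L-lipschitz_on {a..b} x"
    proof (rule lipschitz_onI[OF _ L0])
      fix s t assume "s \<in> {a..b}" "t \<in> {a..b}"
      then show "dist (x s) (x t) \<le> L * dist s t"
        using lip[of s t] lip[of t s]
        by (cases "s \<le> t") (auto simp: dist_norm norm_minus_commute)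
    qed
    then show ?thesis by (rule lipschitz_on_continuous_on)
  qed
  let ?fin = "\<lambda>t. \<exists>C. \<forall>\<^sub>F s in at_right t. (F \<circ> x) s - (F \<circ> x) t \<le> C * (s - t)"
  let ?ae = "\<lambda>t e. \<forall>\<^sub>F s in at_right t. (F \<circ> x) s - (F \<circ> x) t \<le> (M + e) * (s - t)"
  have quot: "?fin t \<and> (\<forall>e>0. t \<notin> N \<longrightarrow> ?ae t e)" if t: "t \<in> {a..<b}" for t
  proof (intro conjI)
    have evab: "\<forall>\<^sub>F s in at_right t. t < s \<and> s < b"
      using t by (intro eventually_at_rightI[of t b]) auto
    define DF where "DF = frechet_derivative F (at (x t))"
    have DF: "(F has_derivative DF) (at (x t))"
      unfolding DF_def using F[of t] t frechet_derivative_works by auto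
    show "?fin t"
    proof -
      obtain K where K: "K > 0" "\<And>y. norm (DF y) \<le> norm y * K"
        using bounded_linear.pos_bounded[OF has_derivative_bounded_linear[OF DF]] by blast
      obtain d where d: "d > 0" "\<And>y. norm (y - x t) < d \<Longrightarrow>
          norm (F y - F (x t) - DF (y - x t)) \<le> 1 * norm (y - x t)"
        using DF[unfolded has_derivative_within_alt] zero_less_one by blast
      have "isCont (\<lambda>s. L * (s - t)) t" by (intro continuous_intros)
      then have "((\<lambda>s. L * (s - t)) \<longlongrightarrow> 0) (at_right t)"
        by (auto simp: isCont_def intro: tendsto_mono[OF at_le])
      then have "\<forall>\<^sub>F s in at_right t. L * (s - t) < d" using d(1) by (rule order_tendstoD)
      with evab have "\<forall>\<^sub>F s in at_right t. (F \<circ> x) s - (F \<circ> x) t \<le> ((K + 1) * L) * (s - t)"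
      proof eventually_elim
        case (elim s)
        have l: "norm (x s - x t) \<le> L * (s - t)" using elim t by (intro lip) auto
        have "F (x s) - F (x t) \<le> norm (DF (x s - x t)) + norm (x s - x t)"
          using d(2)[of "x s"] l elim by simp
        also have "\<dots> \<le> (K + 1) * norm (x s - x t)" using K(2)[of "x s - x t"] by (simp add: algebra_simps)
        also have "\<dots> \<le> (K + 1) * (L * (s - t))" using l K by (intro mult_left_mono) auto
        finally show ?case by (simp add: algebra_simps)
      qed
      then show ?thesis by blast
    qed
    show "\<forall>e>0. t \<notin> N \<longrightarrow> ?ae t e"
    proof (intro allI impI)
      fix e :: real assume e: "e > 0" and tN: "t \<notin> N"
      have "(x has_derivative (\<lambda>h. h *\<^sub>R g t)) (at t within {t..b})"
        unfolding has_derivative_within_alt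
      proof (intro conjI allI impI)
        show "bounded_linear (\<lambda>h. h *\<^sub>R g t)" by (rule bounded_linear_scaleR_left)
        fix e :: real assume "e > 0"
        then obtain d where d: "d > 0" "\<And>h. 0 < h \<Longrightarrow> h < d \<Longrightarrow>
            norm (integral {t..t+h} G /\<^sub>R h - G t) < e"
          using N(2)[of t e] tN by auto
        have "norm (x s - x t - (s - t) *\<^sub>R g t) \<le> e * norm (s - t)"
          if s: "s \<in> {t..b}" "norm (s - t) < d" for s
        proof (cases "s = t")
          case False
          then have h: "0 < s - t" "s - t < d" using s by auto
          have "integral {t..s} G = integral {t..s} g"
            by (rule integral_cong) (use t s in \<open>auto simp: G_def\<close>)
          also have "\<dots> = x s - x t" using incr[of t s] t s by (auto simp: has_integral_iff)
          finally have i: "integral {t..s} G = x s - x t" .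
          have Gt: "G t = g t" using t by (simp add: G_def)
          have "x s - x t - (s - t) *\<^sub>R g t = (s - t) *\<^sub>R ((x s - x t) /\<^sub>R (s - t) - g t)"
            using h by (simp add: scaleR_right_diff_distrib)
          then have "norm (x s - x t - (s - t) *\<^sub>R g t) = (s - t) * norm ((x s - x t) /\<^sub>R (s - t) - g t)"
            using h by simp
          also have "\<dots> \<le> (s - t) * e"
            using d(2)[of "s - t"] h i Gt by (intro mult_left_mono) auto
          finally show ?thesis using h by (simp add: mult.commute)
        qed simp
        then show "\<exists>d>0. \<forall>y\<in>{t..b}. norm (y - t) < d \<longrightarrow>
            norm (x y - x t - (y - t) *\<^sub>R g t) \<le> e * norm (y - t)"
          using d(1) by blast
      qed
      then have "(F \<circ> x has_derivative (DF \<circ> (\<lambda>h. h *\<^sub>R g t))) (at t within {t..b})"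
        by (rule diff_chain_within) (rule has_derivative_at_withinI[OF DF])
      moreover have "DF \<circ> (\<lambda>h. h *\<^sub>R g t) = (*) (DF (g t))"
        using has_derivative_linear[OF DF] by (auto simp: linear_cmul fun_eq_iff)
      ultimately have "(F \<circ> x has_field_derivative DF (g t)) (at t within {t..b})"
        by (simp add: has_field_derivative_def)
      then have "((\<lambda>s. ((F \<circ> x) s - (F \<circ> x) t) / (s - t)) \<longlongrightarrow> DF (g t)) (at t within {t..b})"
        by (simp add: has_field_derivative_iff)
      moreover have "at t within {t..b} = at_right t"
        using t by (simp add: at_within_Icc_at_right)
      moreover have "DF (g t) < M + e" using M[of t] t e by (simp add: DF_def)
      ultimately have "\<forall>\<^sub>F s in at_right t. ((F \<circ> x) s - (F \<circ> x) t) / (s - t) < M + e"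
        by (simp add: order_tendstoD)
      with evab show "?ae t e"
        by eventually_elim (simp add: divide_less_eq)
    qed
  qed
  have "F (x b) - F (x a) = (F \<circ> x) b - (F \<circ> x) a" by simp
  also have "\<dots> \<le> M * (b - a)"
  proof (rule increment_le_of_right_quotients[OF ab _ N(1)])
    show "continuous_on {a..b} (F \<circ> x)"
      by (rule continuous_on_compose[OF contx])
        (use F in \<open>auto intro!: continuous_at_imp_continuous_on differentiable_imp_continuous_within\<close>)
  qed (use quot in auto)
  finally show ?thesis .
qed

section \<open>Class K-infinity functions\<close>

lemma K_infinity_le_iff: "K_infinity a \<Longrightarrow> 0 \<le> s \<Longrightarrow> 0 \<le> t \<Longrightarrow> a s \<le> a t \<longleftrightarrow> s \<le> t"
  unfolding K_infinity_def using strict_mono_on_less_eq[of "{0..}" a s t] by simp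

lemma K_infinity_mono: "K_infinity a \<Longrightarrow> 0 \<le> s \<Longrightarrow> s \<le> t \<Longrightarrow> a s \<le> a t"
  by (simp add: K_infinity_le_iff)

lemma K_infinity_less_iff: "K_infinity a \<Longrightarrow> 0 \<le> s \<Longrightarrow> 0 \<le> t \<Longrightarrow> a s < a t \<longleftrightarrow> s < t"
  by (simp add: K_infinity_le_iff flip: not_le)

lemma K_infinity_zero: "K_infinity a \<Longrightarrow> a 0 = 0"
  unfolding K_infinity_def by simp

lemma K_infinity_nonneg: "K_infinity a \<Longrightarrow> 0 \<le> s \<Longrightarrow> 0 \<le> a s"
  using K_infinity_mono[of a 0 s] by (simp add: K_infinity_zero)

lemma K_infinity_pos: "K_infinity a \<Longrightarrow> 0 < s \<Longrightarrow> 0 < a s"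
  using K_infinity_less_iff[of a 0 s] by (simp add: K_infinity_zero)

lemma K_infinity_surj:
  assumes "K_infinity a" "0 \<le> y"
  shows "y \<in> a ` {0..}"
proof -
  have "\<forall>\<^sub>F s in at_top. y \<le> a s"
    using assms(1) by (simp add: K_infinity_def filterlim_at_top)
  then obtain b where b: "b \<ge> 0" "y \<le> a b"
    by (metis eventually_at_top_linorder linorder_le_cases)
  have "\<exists>s\<ge>0. s \<le> b \<and> a s = y"
    using assms b by (intro IVT') (auto simp: K_infinity_def intro: continuous_on_subset)
  then show ?thesis by auto
qed

lemma K_inv_nonneg: "K_infinity a \<Longrightarrow> 0 \<le> y \<Longrightarrow> 0 \<le> K_inv a y"
  using inv_into_into[OF K_infinity_surj] by fastforce

lemma K_inv_right: "K_infinity a \<Longrightarrow> 0 \<le> y \<Longrightarrow> a (K_inv a y) = y"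
  by (rule f_inv_into_f) (rule K_infinity_surj)

lemma K_inv_left: "K_infinity a \<Longrightarrow> 0 \<le> s \<Longrightarrow> K_inv a (a s) = s"
  by (auto simp: K_infinity_def intro: inv_into_f_f strict_mono_on_imp_inj_on)

lemma le_K_inv_iff: "K_infinity a \<Longrightarrow> 0 \<le> s \<Longrightarrow> 0 \<le> y \<Longrightarrow> s \<le> K_inv a y \<longleftrightarrow> a s \<le> y"
  using K_infinity_le_iff[of a s "K_inv a y"] by (simp add: K_inv_nonneg K_inv_right)

lemma K_inv_le_iff: "K_infinity a \<Longrightarrow> 0 \<le> s \<Longrightarrow> 0 \<le> y \<Longrightarrow> K_inv a y \<le> s \<longleftrightarrow> y \<le> a s"
  using K_infinity_le_iff[of a "K_inv a y" s] by (simp add: K_inv_nonneg K_inv_right)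

section \<open>Solutions under a held input\<close>

text \<open>Breaks circular estimates: \<open>step\<close> improves a non-strict bound on the past
  to a strict one at the present, which contradicts equality at the first time R is reached.\<close>

lemma first_exit_barrier:
  fixes g :: "real \<Rightarrow> real"
  assumes cont: "continuous_on {a..b} g" and a: "g a < R"
    and step: "\<And>t. t \<in> {a..b} \<Longrightarrow> (\<And>r. r \<in> {a..t} \<Longrightarrow> g r \<le> R) \<Longrightarrow> g t < R"
    and t: "t \<in> {a..b}"
  shows "g t < R"
proof (rule ccontr)
  assume nt: "\<not> g t < R"
  define B where "B = {a..b} \<inter> g -` {R..}"
  define c where "c = Inf B"
  have "closed B" unfolding B_def by (rule continuous_closed_preimage[OF cont]) auto
  moreover have tB: "t \<in> B" using t nt by (simp add: B_def)
  moreover have bdd: "bdd_below B" by (rule bdd_belowI[of _ a]) (simp add: B_def)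
  ultimately have cB: "c \<in> B" unfolding c_def by (intro closed_contains_Inf) auto
  then have c: "a \<le> c" "c \<le> b" "R \<le> g c" by (auto simp: B_def)
  have low: "c \<le> r" if "r \<in> B" for r unfolding c_def by (rule cInf_lower[OF that bdd])
  \<comment> \<open>By minimality the crossing found here is c itself. Hence \<open>g c = R\<close>
    exactly, and the closed hypothesis of \<open>step\<close> also holds at its right end.\<close>
  obtain e where e: "a \<le> e" "e \<le> c" "g e = R"
    using IVT'[of g a R c] c a continuous_on_subset[OF cont] by auto
  then have "e = c" using low[of e] c by (auto simp: B_def)
  have "g c < R"
  proof (rule step)
    fix r assume r: "r \<in> {a..c}"
    show "g r \<le> R"
    proof (rule ccontr)
      assume "\<not> g r \<le> R"
      then have "c \<le> r" using r c by (intro low) (auto simp: B_def)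
      then show False using r \<open>\<not> g r \<le> R\<close> e \<open>e = c\<close> by auto
    qed
  qed (use c in auto)
  then show False using c by simp
qed

text \<open>The input u is a separate parameter, so a restriction to a later subinterval keeps the
  old sample, and a truncated right-hand side fits the same predicate.\<close>

definition held_solution ::
    "('a::euclidean_space \<Rightarrow> 'b \<Rightarrow> 'c \<Rightarrow> 'a) \<Rightarrow> 'b \<Rightarrow> (real \<Rightarrow> 'c) \<Rightarrow> real \<Rightarrow> real \<Rightarrow> (real \<Rightarrow> 'a) \<Rightarrow> bool" where
  "held_solution f u d a b x \<longleftrightarrow>
     (\<forall>s\<in>{a..b}. ((\<lambda>r. f (x r) u (d r)) has_integral (x s - x a)) {a..s})"

lemma held_solution_subinterval:
  assumes "held_solution f u d a b x" "a \<le> a'" "b' \<le> b"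
  shows "held_solution f u d a' b' x"
  unfolding held_solution_def
proof
  fix s assume s: "s \<in> {a'..b'}"
  let ?g = "\<lambda>r. f (x r) u (d r)"
  have int: "(?g has_integral (x r - x a)) {a..r}" if "r \<in> {a..b}" for r
    using assms(1) that unfolding held_solution_def by blast
  have sb: "s \<in> {a..b}" "a' \<in> {a..b}" using s assms by auto
  have "?g integrable_on {a..s}" using int[OF sb(1)] by auto
  then have i: "?g integrable_on {a'..s}" using assms(2) by (auto intro: integrable_on_subinterval)
  have "(?g has_integral (x a' - x a) + integral {a'..s} ?g) {a..s}"
    using assms(2) s int[OF sb(2)] i by (intro has_integral_combine[of a a' s]) (auto simp: integrable_integral)
  then have "x s - x a = (x a' - x a) + integral {a'..s} ?g"
    using has_integral_unique[OF int[OF sb(1)]] by simp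
  then show "(?g has_integral (x s - x a')) {a'..s}"
    using i by (simp add: has_integral_iff)
qed

lemma held_solution_continuous:
  assumes "held_solution f u d a b x"
  shows "continuous_on {a..b} x"
proof (cases "a \<le> b")
  case True
  let ?g = "\<lambda>r. f (x r) u (d r)"
  have int: "(?g has_integral (x r - x a)) {a..r}" if "r \<in> {a..b}" for r
    using assms(1) that unfolding held_solution_def by blast
  have "continuous_on {a..b} (\<lambda>s. x a + integral {a..s} ?g)"
    using int[of b] True by (intro continuous_intros indefinite_integral_continuous_1) auto
  then show ?thesis
    by (rule continuous_on_eq) (use int in \<open>fastforce dest: integral_unique\<close>)
qed simp

lemma cont_differentiable_continuous:
  "cont_differentiable F \<Longrightarrow> continuous_on S F"
  unfolding cont_differentiable_def
  by (meson has_derivative_continuous continuous_at_imp_continuous_on)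

lemma held_solution_bounded_rhs:
  fixes f :: "'a::euclidean_space \<Rightarrow> 'b::real_normed_vector \<Rightarrow> 'c::real_normed_vector \<Rightarrow> 'a"
  assumes sol: "held_solution f u d a b x" and d: "\<And>r. r \<in> {a..b} \<Longrightarrow> d r \<in> D"
    and D: "compact D" and f: "cont_differentiable (\<lambda>(x, u, d). f x u d)"
  obtains L where "\<And>r. r \<in> {a..b} \<Longrightarrow> norm (f (x r) u (d r)) \<le> L"
proof -
  have "compact (x ` {a..b} \<times> {u} \<times> D)"
    using held_solution_continuous[OF sol] D
    by (intro compact_Times compact_continuous_image) auto
  then have "compact ((\<lambda>(x, u, d). f x u d) ` (x ` {a..b} \<times> {u} \<times> D))"
    by (intro compact_continuous_image cont_differentiable_continuous f)
  then obtain L where L: "\<And>z. z \<in> x ` {a..b} \<times> {u} \<times> D \<Longrightarrow> norm ((\<lambda>(x, u, d). f x u d) z) \<le> L"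
    using compact_imp_bounded bounded_iff by (metis imageI)
  show thesis
  proof
    fix r assume "r \<in> {a..b}"
    then show "norm (f (x r) u (d r)) \<le> L" using L[of "(x r, u, d r)"] d by auto
  qed
qed

section \<open>Existence of Caratheodory solutions by Picard iteration\<close>

text \<open>Since d is merely measurable, F is not continuous in time; integrability along
  continuous curves is all that the Picard operator needs to be defined.\<close>

lemma caratheodory_lipschitz_exists:
  fixes F :: "real \<Rightarrow> 'a::euclidean_space \<Rightarrow> 'a"
  assumes ab: "a \<le> b"
    and lip: "\<And>r y z. r \<in> {a..b} \<Longrightarrow> norm (F r y - F r z) \<le> L * norm (y - z)"
    and integrable: "\<And>y. continuous_on {a..b} y \<Longrightarrow> (\<lambda>r. F r (y r)) integrable_on {a..b}"
  obtains y where "y a = x0"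
    "\<And>s. s \<in> {a..b} \<Longrightarrow> ((\<lambda>r. F r (y r)) has_integral (y s - x0)) {a..s}"
proof -
  define L' where "L' = max L 1"
  have L': "L' > 0" by (simp add: L'_def)
  have lip': "norm (F r y - F r z) \<le> L' * norm (y - z)" if "r \<in> {a..b}" for r y z
    by (rule order_trans[OF lip[OF that]]) (simp add: L'_def mult_right_mono)
  \<comment> \<open>The 2 in the exponent yields the contraction factor 1/2: \<open>L' * E\<close>
    has the antiderivative \<open>E / 2\<close>.\<close>
  define E where "E r = exp (2 * L' * (r - a))" for r
  have E0: "E r > 0" for r by (simp add: E_def)
  have contE: "continuous_on T E" for T unfolding E_def by (intro continuous_intros)
  define J where "J z c = inverse (E c) *\<^sub>R (x0 + integral {a..c} (\<lambda>r. F r (E r *\<^sub>R z r)))" for z c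
  have int: "(\<lambda>r. F r (E r *\<^sub>R z r)) integrable_on {a..b}" if "continuous_on {a..b} z" for z
    by (rule integrable) (intro continuous_intros contE that)
  have int': "(\<lambda>r. F r (E r *\<^sub>R z r)) integrable_on {a..c}" if "continuous_on {a..b} z" "c \<in> {a..b}" for z c
    using int[OF that(1)] that(2) by (auto intro: integrable_on_subinterval)
  have contJ: "continuous_on (cbox a b) (J z)" if "continuous_on {a..b} z" for z
    unfolding J_def using indefinite_integral_continuous_1[OF int[OF that]] E0
    by (auto intro!: continuous_intros contE simp: less_imp_neq[symmetric])
  \<comment> \<open>Clamping the argument extends functions on \<open>{a..b}\<close> to bounded
    continuous ones on the line, which form a complete space.\<close>
  define \<Phi> where "\<Phi> z = Bcontfun (\<lambda>s. J (apply_bcontfun z) (clamp a b s))" for z :: "real \<Rightarrow>\<^sub>C 'a"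
  have \<Phi>: "apply_bcontfun (\<Phi> z) s = J (apply_bcontfun z) (clamp a b s)" for z s
  proof -
    have "continuous_on UNIV (\<lambda>s. J (apply_bcontfun z) (clamp a b s))"
      by (intro clamp_continuous_on contJ) simp
    moreover have "bounded (range (\<lambda>s. J (apply_bcontfun z) (clamp a b s)))"
      by (intro clamp_bounded compact_imp_bounded compact_continuous_image contJ) auto
    ultimately show ?thesis
      unfolding \<Phi>_def by (subst Bcontfun_inverse) (auto simp: bcontfun_def)
  qed
  txt \<open>The substitution \<open>y = E z\<close> with an exponential weight makes the Picard operator a contraction
    on the whole interval, without splitting it into short pieces.\<close>
  have "\<exists>!z. \<Phi> z = z"
  proof (rule banach_fix_type[of "1/2"], safe)
    fix z z' :: "real \<Rightarrow>\<^sub>C 'a"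
    show "dist (\<Phi> z) (\<Phi> z') \<le> 1/2 * dist z z'"
    proof (rule dist_bound)
      fix s
      define c where "c = clamp a b s"
      have c: "c \<in> {a..b}" using clamp_in_interval[of a b s] ab by (simp add: c_def)
      let ?k = "L' * dist z z'"
      have hi: "((\<lambda>r. ?k * E r) has_integral (dist z z' / 2 * E c - dist z z' / 2 * E a)) {a..c}"
        using c L' unfolding E_def
        by (intro fundamental_theorem_of_calculus)
          (auto intro!: derivative_eq_intros simp flip: has_real_derivative_iff_has_vector_derivative)
      have zc: "continuous_on {a..b} (apply_bcontfun z)" "continuous_on {a..b} (apply_bcontfun z')" by auto
      have "norm (integral {a..c} (\<lambda>r. F r (E r *\<^sub>R z r)) - integral {a..c} (\<lambda>r. F r (E r *\<^sub>R z' r)))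
          = norm (integral {a..c} (\<lambda>r. F r (E r *\<^sub>R z r) - F r (E r *\<^sub>R z' r)))"
        by (subst integral_diff) (use int'[OF _ c] zc in auto)
      also have "\<dots> \<le> integral {a..c} (\<lambda>r. ?k * E r)"
      proof (rule integral_norm_bound_integral)
        show "(\<lambda>r. F r (E r *\<^sub>R z r) - F r (E r *\<^sub>R z' r)) integrable_on {a..c}"
          by (intro integrable_diff int' zc c)
        show "(\<lambda>r. ?k * E r) integrable_on {a..c}" using hi by blast
        fix r assume r: "r \<in> {a..c}"
        have "norm (F r (E r *\<^sub>R z r) - F r (E r *\<^sub>R z' r)) \<le> L' * norm (E r *\<^sub>R z r - E r *\<^sub>R z' r)"
          using r c by (intro lip') auto
        also have "norm (E r *\<^sub>R z r - E r *\<^sub>R z' r) = E r * dist (z r) (z' r)"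
          using E0[of r] by (simp add: dist_norm flip: scaleR_diff_right)
        also have "L' * (E r * dist (z r) (z' r)) \<le> L' * (E r * dist z z')"
          using L' E0[of r] by (intro mult_left_mono dist_bounded) auto
        finally show "norm (F r (E r *\<^sub>R z r) - F r (E r *\<^sub>R z' r)) \<le> ?k * E r" by (simp add: mult_ac)
      qed
      also have "\<dots> = dist z z' / 2 * E c - dist z z' / 2 * E a" using hi by (rule integral_unique)
      also have "\<dots> \<le> dist z z' / 2 * E c" using E0[of a] by simp
      finally have bnd: "norm (integral {a..c} (\<lambda>r. F r (E r *\<^sub>R z r)) - integral {a..c} (\<lambda>r. F r (E r *\<^sub>R z' r)))
          \<le> dist z z' / 2 * E c" .
      have "dist (\<Phi> z s) (\<Phi> z' s) = inverse (E c) *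
          norm (integral {a..c} (\<lambda>r. F r (E r *\<^sub>R z r)) - integral {a..c} (\<lambda>r. F r (E r *\<^sub>R z' r)))"
        using E0[of c]
        by (simp add: \<Phi> J_def dist_norm flip: c_def scaleR_diff_right)
      also have "\<dots> \<le> inverse (E c) * (dist z z' / 2 * E c)"
        using E0[of c] bnd by (intro mult_left_mono) auto
      also have "\<dots> = 1/2 * dist z z'" using E0[of c] by simp
      finally show "dist (\<Phi> z s) (\<Phi> z' s) \<le> 1/2 * dist z z'" .
    qed
  qed auto
  then obtain z where z: "\<Phi> z = z" by blast
  define y where "y r = E r *\<^sub>R z r" for r
  have ys: "y s = x0 + integral {a..s} (\<lambda>r. F r (y r))" if "s \<in> {a..b}" for s
  proof -
    have "clamp a b s = s" using that by simp
    then have "z s = J (apply_bcontfun z) s" using \<Phi>[of z s] z by simp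
    then show ?thesis using E0[of s] by (simp add: y_def J_def)
  qed
  show thesis
  proof
    show "y a = x0" using ys[of a] ab by simp
    show "((\<lambda>r. F r (y r)) has_integral (y s - x0)) {a..s}" if s: "s \<in> {a..b}" for s
      using int'[of "apply_bcontfun z" s] s ys[OF s] by (auto simp: has_integral_iff y_def)
  qed
qed

text \<open>Mean value inequality on the convex set C; compactness of D makes the constant uniform
  in d, hence in time.\<close>

lemma cont_differentiable_lipschitz_on_compact:
  fixes f :: "'a::real_normed_vector \<Rightarrow> 'b::real_normed_vector \<Rightarrow> 'c::real_normed_vector \<Rightarrow> 'd::real_normed_vector"
  assumes f: "cont_differentiable (\<lambda>(x, u, d). f x u d)"
    and C: "compact C" "convex C" and D: "compact D"
  obtains L where "\<And>x y d. x \<in> C \<Longrightarrow> y \<in> C \<Longrightarrow> d \<in> D \<Longrightarrow> norm (f x u d - f y u d) \<le> L * norm (x - y)"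
proof -
  obtain F' where F': "\<And>z. ((\<lambda>(x, u, d). f x u d) has_derivative blinfun_apply (F' z)) (at z)"
      "continuous_on UNIV F'"
    using f unfolding cont_differentiable_def by blast
  have "compact (F' ` (C \<times> {u} \<times> D))"
    by (intro compact_continuous_image compact_Times C D)
      (auto intro: continuous_on_subset[OF F'(2)])
  then obtain L where L: "\<And>z. z \<in> C \<times> {u} \<times> D \<Longrightarrow> norm (F' z) \<le> L"
    using compact_imp_bounded bounded_iff by (metis imageI)
  show thesis
  proof
    fix x y d assume xyd: "x \<in> C" "y \<in> C" "d \<in> D"
    show "norm (f x u d - f y u d) \<le> L * norm (x - y)"
    proof (rule differentiable_bound[OF C(2) _ _ xyd(1,2)])
      fix z assume z: "z \<in> C"
      have "((\<lambda>z. (z, u, d)) has_derivative (\<lambda>v. (v, 0, 0))) (at z within C)"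
        by (auto intro!: derivative_eq_intros simp: zero_prod_def)
      from has_derivative_compose[OF this, of "\<lambda>(x, u, d). f x u d"] F'(1)[of "(z, u, d)"]
      show "((\<lambda>z. f z u d) has_derivative (\<lambda>v. F' (z, u, d) (v, 0, 0))) (at z within C)"
        by simp
      show "onorm (\<lambda>v. F' (z, u, d) (v, 0, 0)) \<le> L"
      proof (rule onorm_bound)
        show "0 \<le> L" using order_trans[OF norm_ge_zero L[of "(z, u, d)"]] z xyd by simp
        fix v :: 'a
        have "norm (F' (z, u, d) (v, 0, 0)) \<le> norm (F' (z, u, d)) * norm (v, 0::'b, 0::'c)"
          by (rule norm_blinfun)
        also have "\<dots> \<le> L * norm v"
          using L[of "(z, u, d)"] z xyd by (auto simp: norm_Pair intro: mult_right_mono)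
        finally show "norm (F' (z, u, d) (v, 0, 0)) \<le> L * norm v" .
      qed
    qed
  qed
qed

text \<open>Nearest-point projection to a ball does not increase distances, so composing with it
  turns the local Lipschitz bound of f into a global one. The truncated solution therefore exists on
  intervals of any length.\<close>

lemma truncated_held_solution_exists:
  fixes f :: "'a::euclidean_space \<Rightarrow> 'b::euclidean_space \<Rightarrow> 'c::euclidean_space \<Rightarrow> 'a"
  assumes f: "cont_differentiable (\<lambda>(x, u, d). f x u d)" and D: "compact D"
    and ab: "a \<le> b" and \<rho>: "0 \<le> \<rho>"
    and dm: "d \<in> borel_measurable (lebesgue_on {a..b})" and dD: "\<And>r. r \<in> {a..b} \<Longrightarrow> d r \<in> D"
  obtains y where "y a = x0" "held_solution (\<lambda>x. f (closest_point (cball 0 \<rho>) x)) u d a b y"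
proof -
  let ?P = "closest_point (cball (0::'a) \<rho>)"
  have P: "?P x \<in> cball 0 \<rho>" for x using \<rho> by (intro closest_point_in_set) auto
  obtain L where L: "\<And>x y e. x \<in> cball 0 \<rho> \<Longrightarrow> y \<in> cball 0 \<rho> \<Longrightarrow> e \<in> D \<Longrightarrow> norm (f x u e - f y u e) \<le> L * norm (x - y)"
    using cont_differentiable_lipschitz_on_compact[OF f compact_cball convex_cball D] by metis
  have "compact ((\<lambda>(x, u, d). f x u d) ` (cball 0 \<rho> \<times> {u} \<times> D))"
    by (intro compact_continuous_image cont_differentiable_continuous f compact_Times compact_cball D) auto
  then obtain B where B: "\<And>z. z \<in> cball 0 \<rho> \<times> {u} \<times> D \<Longrightarrow> norm ((\<lambda>(x, u, d). f x u d) z) \<le> B"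
    using compact_imp_bounded bounded_iff by (metis imageI)
  obtain y where y: "y a = x0" "\<And>s. s \<in> {a..b} \<Longrightarrow> ((\<lambda>r. f (?P (y r)) u (d r)) has_integral (y s - x0)) {a..s}"
  proof (rule caratheodory_lipschitz_exists[OF ab, of "\<lambda>r x. f (?P x) u (d r)" "max L 0" x0])
    fix r y z assume r: "r \<in> {a..b}"
    have "norm (f (?P y) u (d r) - f (?P z) u (d r)) \<le> L * norm (?P y - ?P z)"
      using r dD by (intro L P) auto
    also have "\<dots> \<le> max L 0 * norm (?P y - ?P z)" by (intro mult_right_mono) auto
    also have "\<dots> \<le> max L 0 * norm (y - z)"
      using closest_point_lipschitz[of "cball (0::'a) \<rho>" y z] \<rho>
      by (intro mult_left_mono) (auto simp: dist_norm)
    finally show "norm (f (?P y) u (d r) - f (?P z) u (d r)) \<le> max L 0 * norm (y - z)" .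
  next
    fix y :: "real \<Rightarrow> 'a" assume y: "continuous_on {a..b} y"
    have "continuous_on {a..b} (\<lambda>r. ?P (y r))"
      using continuous_on_compose[OF y continuous_on_closest_point[of "cball (0::'a) \<rho>"]] \<rho>
      by (simp add: o_def)
    then have "(\<lambda>r. ?P (y r)) \<in> borel_measurable (lebesgue_on {a..b})"
      by (rule continuous_imp_measurable_on_sets_lebesgue) simp
    then have "(\<lambda>r. (?P (y r), u, d r)) \<in> borel_measurable (lebesgue_on {a..b})"
      by (intro borel_measurable_Pair dm) auto
    from borel_measurable_continuous_on[OF cont_differentiable_continuous[OF f] this]
    have meas: "(\<lambda>r. f (?P (y r)) u (d r)) \<in> borel_measurable (lebesgue_on {a..b})" by simp
    show "(\<lambda>r. f (?P (y r)) u (d r)) integrable_on {a..b}"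
    proof (rule measurable_bounded_by_integrable_imp_integrable[OF meas])
      show "(\<lambda>_. B) integrable_on {a..b}" by (rule integrable_const_ivl)
      show "norm (f (?P (y r)) u (d r)) \<le> B" if "r \<in> {a..b}" for r
        using B[of "(?P (y r), u, d r)"] P dD[OF that] by auto
    qed simp
  qed blast
  show thesis by (rule that[of y]) (simp_all add: held_solution_def y)
qed

section \<open>One sampling interval\<close>

text \<open>\<open>\<gamma>_dom\<close> condenses \<open>\<alpha>hat_w s > \<sigma>_q s / 2\<close>
  and \<open>\<gamma> s > \<alpha>hat_w s + \<alpha>_w s\<close> into the rate bound for
  \<open>V_q + 2 U\<close>.\<close>

locale iss_sampled_loop =
  fixes f :: "real^'n \<Rightarrow> real^'m \<Rightarrow> real^'e \<Rightarrow> real^'n"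
    and h :: "real^'n \<Rightarrow> real^'q"
    and \<kappa> :: "real^'q \<Rightarrow> real^'m"
    and D :: "(real^'e) set"
    and V_q :: "real^'n \<Rightarrow> real"
    and U :: "real^'m \<Rightarrow> real"
    and al_w au_w \<alpha>_w \<sigma>_w :: "real \<Rightarrow> real"
    and al_q au_q \<alpha>_q \<sigma>_q :: "real \<Rightarrow> real"
    and \<gamma> :: "real \<Rightarrow> real"
  assumes D: "compact D"
    and f: "cont_differentiable (\<lambda>(x, u, d). f x u d)"
    and Kdiff: "(\<kappa> \<circ> h) differentiable_on UNIV"
    and U: "error_growth D (psi_closed f h \<kappa>) U al_w au_w \<alpha>_w \<sigma>_w"
    and \<alpha>_q: "\<And>s. s > 0 \<Longrightarrow> \<alpha>_q s > 2 * \<sigma>_w s"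
    and V_q: "iss_lyapunov D (f_closed f h \<kappa>) V_q al_q au_q \<alpha>_q \<sigma>_q"
    and \<gamma>: "K_infinity \<gamma>"
    and \<gamma>_dom: "\<And>s. s > 0 \<Longrightarrow> \<sigma>_q s + 2 * \<alpha>_w s \<le> 2 * \<gamma> s"
    and \<gamma>_O: "O_at_zero \<gamma> al_w"
begin

abbreviation K where "K \<equiv> \<kappa> \<circ> h"

lemma K_functions:
  "K_infinity al_w" "K_infinity au_w" "K_infinity \<alpha>_w" "K_infinity \<sigma>_w"
  "K_infinity al_q" "K_infinity au_q" "K_infinity \<alpha>_q" "K_infinity \<sigma>_q"
  using U V_q by (auto simp: error_growth_def iss_lyapunov_def)

lemma V_q_bounds: "al_q (norm x) \<le> V_q x" "V_q x \<le> au_q (norm x)"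
  using V_q by (auto simp: iss_lyapunov_def)

lemma U_bounds: "al_w (norm w) \<le> U w" "U w \<le> au_w (norm w)"
  using U by (auto simp: error_growth_def)

lemma U_zero: "U 0 = 0"
  using U_bounds[of 0] K_functions by (simp add: K_infinity_zero)

lemma V_q_nonneg: "0 \<le> V_q x"
  using V_q_bounds(1)[of x] K_infinity_nonneg[OF K_functions(5), of "norm x"] by simp

lemma V_q_le_zero_iff: "V_q x \<le> 0 \<longleftrightarrow> x = 0"
proof (cases "x = 0")
  case True
  then show ?thesis using V_q_bounds(2)[of 0] K_infinity_zero[OF K_functions(6)] by simp
next
  case False
  then show ?thesis
    using V_q_bounds(1)[of x] K_infinity_pos[OF K_functions(5), of "norm x"] by simp
qed

lemma \<gamma>_dom': "0 \<le> s \<Longrightarrow> \<sigma>_q s + 2 * \<alpha>_w s \<le> 2 * \<gamma> s"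
  using \<gamma>_dom[of s] K_functions \<gamma> by (cases "s = 0") (auto simp: K_infinity_zero)

lemma \<alpha>_q': "0 \<le> s \<Longrightarrow> 2 * \<sigma>_w s \<le> \<alpha>_q s"
  using \<alpha>_q[of s] K_functions by (cases "s = 0") (auto simp: K_infinity_zero)

end

text \<open>Only the left end is tied to sampling, through the input \<open>K (x a)\<close>. The
  right end is free, so that partial intervals and restarts from the origin are covered as
  well.\<close>

locale held_interval =
  iss_sampled_loop f h \<kappa> D V_q U al_w au_w \<alpha>_w \<sigma>_w al_q au_q \<alpha>_q \<sigma>_q \<gamma>
  for f :: "real^'n \<Rightarrow> real^'m \<Rightarrow> real^'e \<Rightarrow> real^'n"
    and h :: "real^'n \<Rightarrow> real^'q"
    and \<kappa> D V_q U al_w au_w \<alpha>_w \<sigma>_w al_q au_q \<alpha>_q \<sigma>_q \<gamma> +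
  fixes d :: "real \<Rightarrow> real^'e" and a b :: real and x :: "real \<Rightarrow> real^'n"
  assumes ab: "a \<le> b" and d: "\<And>r. r \<in> {a..b} \<Longrightarrow> d r \<in> D"
    and sol: "held_solution f (K (x a)) d a b x"
begin

definition w where "w r = K (x a) - K (x r)"

lemma w_start: "w a = 0" by (simp add: w_def)

lemma continuous_x: "continuous_on {a..b} x"
  by (rule held_solution_continuous[OF sol])

lemma continuous_w: "continuous_on {a..b} w"
  unfolding w_def
  using continuous_on_compose[OF continuous_x, of K] differentiable_imp_continuous_on[OF Kdiff]
  by (intro continuous_intros) (auto simp: o_def intro: continuous_on_subset)

text \<open>The weights serve \<open>V_q\<close> alone, U alone and \<open>V_q + 2 U\<close> at
  once. U is taken as the function \<open>U (K (x a) - K y)\<close> of the state y, because x is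
  absolutely continuous while w need not be; its derivative along f is the one bounded through
  \<open>psi_closed\<close>.\<close>

lemma increment_bound:
  assumes st: "a \<le> s" "s \<le> t" "t \<le> b" and c: "0 \<le> c1" "0 \<le> c2"
    and M: "\<And>r. r \<in> {s..t} \<Longrightarrow> c1 * (- \<alpha>_q (norm (x r)) + \<sigma>_q (norm (w r)))
        + c2 * (\<alpha>_w (norm (w r)) + \<sigma>_w (norm (x r))) \<le> M"
  shows "c1 * (V_q (x t) - V_q (x s)) + c2 * (U (w t) - U (w s)) \<le> M * (t - s)"
proof -
  define F where "F y = c1 * V_q y + c2 * U (K (x a) - K y)" for y
  define g where "g r = f (x r) (K (x a)) (d r)" for r
  have sol': "held_solution f (K (x a)) d s t x"
    using held_solution_subinterval[OF sol] st by simp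
  obtain L where L: "\<And>r. r \<in> {s..t} \<Longrightarrow> norm (g r) \<le> L"
    using held_solution_bounded_rhs[OF sol' _ D f] d st unfolding g_def by auto
  have F': "(F has_derivative (\<lambda>v. c1 * frechet_derivative V_q (at y) v
      + c2 * frechet_derivative U (at (K (x a) - K y)) (- frechet_derivative K (at y) v))) (at y)" for y
  proof -
    have V': "(V_q has_derivative frechet_derivative V_q (at y)) (at y)"
      using V_q frechet_derivative_works unfolding iss_lyapunov_def cont_differentiable_def differentiable_def
      by blast
    have K': "(K has_derivative frechet_derivative K (at y)) (at y)"
      using Kdiff frechet_derivative_works by (auto simp: differentiable_on_def)
    have "((\<lambda>z. K (x a) - K z) has_derivative (\<lambda>v. - frechet_derivative K (at y) v)) (at y)"
      using has_derivative_diff[OF has_derivative_const K'] by simp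
    moreover have "(U has_derivative frechet_derivative U (at u)) (at u)" for u
      using U frechet_derivative_works unfolding error_growth_def cont_differentiable_def differentiable_def
      by blast
    ultimately have "((\<lambda>z. U (K (x a) - K z)) has_derivative
        (\<lambda>v. frechet_derivative U (at (K (x a) - K y)) (- frechet_derivative K (at y) v))) (at y)"
      by (rule has_derivative_compose)
    then show ?thesis
      unfolding F_def by (intro has_derivative_add has_derivative_mult_right V')
  qed
  have "F (x t) - F (x s) \<le> M * (t - s)"
  proof (rule increment_along_integral_curve[where g = g])
    show "(g has_integral x r - x s) {s..r}" if "r \<in> {s..t}" for r
      using sol' that unfolding held_solution_def g_def by blast
    show "F differentiable at (x r)" for r using F' by (auto simp: differentiable_def)
    fix r assume r: "r \<in> {s..t}"
    then have dr: "d r \<in> D" using d st by auto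
    have g1: "g r = f_closed f h \<kappa> (x r) (w r) (d r)"
      by (simp add: g_def f_closed_def w_def)
    then have g2: "- frechet_derivative K (at (x r)) (g r) = psi_closed f h \<kappa> (x r) (w r) (d r)"
      by (simp add: psi_closed_def)
    have "frechet_derivative V_q (at (x r)) (g r) \<le> - \<alpha>_q (norm (x r)) + \<sigma>_q (norm (w r))"
      using V_q dr unfolding g1 iss_lyapunov_def by blast
    moreover have "frechet_derivative U (at (w r)) (- frechet_derivative K (at (x r)) (g r))
        \<le> \<alpha>_w (norm (w r)) + \<sigma>_w (norm (x r))"
      using U dr unfolding g2 error_growth_def by blast
    ultimately show "frechet_derivative F (at (x r)) (g r) \<le> M"
      using M[OF r] c unfolding frechet_derivative_at[OF F', symmetric] w_def
      by (smt (verit) mult_left_mono)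
  qed (use st L in auto)
  then show ?thesis by (simp add: F_def w_def algebra_simps)
qed

lemma decrease_of_small_error:
  assumes R: "\<And>s. 0 < s \<Longrightarrow> s \<le> R \<Longrightarrow> 2 * (b - a) * \<gamma> s < al_w s"
    and t: "t \<in> {a..b}" and wR: "\<And>r. r \<in> {a..t} \<Longrightarrow> norm (w r) \<le> R" and s: "s \<in> {a..t}"
  shows "V_q (x t) \<le> V_q (x a) - al_w (norm (w s))"
proof -
  have "continuous_on {a..t} (\<lambda>r. norm (w r))"
    using continuous_w t by (intro continuous_on_norm) (auto intro: continuous_on_subset)
  then obtain p where p: "p \<in> {a..t}" "\<And>r. r \<in> {a..t} \<Longrightarrow> norm (w r) \<le> norm (w p)"
    using continuous_attains_sup[of "{a..t}" "\<lambda>r. norm (w r)"] t by auto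
  define m where "m = norm (w p)"
  have m0: "0 \<le> m" by (simp add: m_def)
  have rate: "\<sigma>_q (norm (w r)) + 2 * \<alpha>_w (norm (w r)) \<le> 2 * \<gamma> m" if "r \<in> {a..t}" for r
    using K_infinity_mono[OF \<gamma>, of "norm (w r)" m] \<gamma>_dom'[of "norm (w r)"] p(2)[OF that]
    by (simp add: m_def)
  txt \<open>Up to the time \<open>p\<close> at which the error is largest, use \<open>V_q + 2 U\<close>; there \<open>U\<close> has gained at
    least \<open>al_w m\<close>, and this gain outweighs the possible growth of \<open>V_q\<close> alone after \<open>p\<close>.\<close>
  have "1 * (V_q (x p) - V_q (x a)) + 2 * (U (w p) - U (w a)) \<le> (2 * \<gamma> m) * (p - a)"
  proof (rule increment_bound)
    fix r assume "r \<in> {a..p}"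
    then have "r \<in> {a..t}" using p by auto
    from rate[OF this] show "1 * (- \<alpha>_q (norm (x r)) + \<sigma>_q (norm (w r)))
        + 2 * (\<alpha>_w (norm (w r)) + \<sigma>_w (norm (x r))) \<le> 2 * \<gamma> m"
      using \<alpha>_q'[of "norm (x r)"] by simp
  qed (use p t in auto)
  then have 1: "V_q (x p) + 2 * U (w p) \<le> V_q (x a) + 2 * \<gamma> m * (p - a)"
    by (simp add: w_start U_zero)
  have "1 * (V_q (x t) - V_q (x p)) + 0 * (U (w t) - U (w p)) \<le> (2 * \<gamma> m) * (t - p)"
  proof (rule increment_bound)
    fix r assume "r \<in> {p..t}"
    then have "r \<in> {a..t}" using p by auto
    from rate[OF this] show "1 * (- \<alpha>_q (norm (x r)) + \<sigma>_q (norm (w r)))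
        + 0 * (\<alpha>_w (norm (w r)) + \<sigma>_w (norm (x r))) \<le> 2 * \<gamma> m"
      using K_infinity_nonneg[OF K_functions(7), of "norm (x r)"]
        K_infinity_nonneg[OF K_functions(3), of "norm (w r)"] by simp
  qed (use p t in auto)
  then have 2: "V_q (x t) \<le> V_q (x p) + 2 * \<gamma> m * (t - p)" by simp
  have "2 * \<gamma> m * (t - a) \<le> 2 * \<gamma> m * (b - a)"
    using t K_infinity_nonneg[OF \<gamma> m0] by (intro mult_left_mono) auto
  \<comment> \<open>The condition on the interval length speaks of positive arguments only; at m = 0
    both sides vanish.\<close>
  also have "2 * \<gamma> m * (b - a) \<le> al_w m"
  proof (cases "m = 0")
    case True
    then show ?thesis by (simp add: K_infinity_zero[OF \<gamma>] K_infinity_zero[OF K_functions(1)])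
  next
    case False
    then have "2 * (b - a) * \<gamma> m < al_w m" using wR[OF p(1)] m0 by (intro R) (auto simp: m_def)
    then show ?thesis by (simp add: algebra_simps)
  qed
  finally have rate_m: "2 * \<gamma> m * (t - a) \<le> al_w m" .
  have "al_w (norm (w s)) \<le> al_w m"
    using p(2)[OF s] K_infinity_mono[OF K_functions(1)] by (simp add: m_def)
  moreover have "al_w m \<le> U (w p)" using U_bounds by (simp add: m_def)
  ultimately show ?thesis using 1 2 rate_m by (simp add: algebra_simps)
qed

lemma interval_estimate_pos:
  assumes Rpos: "R > 0" and R: "\<And>s. 0 < s \<Longrightarrow> s \<le> R \<Longrightarrow> 2 * (b - a) * \<gamma> s < al_w s"
    and start: "V_q (x a) \<le> al_q (K_inv \<sigma>_w (\<alpha>_w R))" and t: "t \<in> {a..b}"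
  shows "norm (w t) \<le> R" and "s \<in> {a..t} \<Longrightarrow> V_q (x t) \<le> V_q (x a) - al_w (norm (w s))"
proof -
  have nt: "norm (w t) < R" if "t \<in> {a..b}" for t
  proof (rule first_exit_barrier[of a b "\<lambda>r. norm (w r)", OF _ _ _ that])
    show "continuous_on {a..b} (\<lambda>r. norm (w r))" using continuous_w by (intro continuous_intros)
    show "norm (w a) < R" using Rpos by (simp add: w_start)
    fix t assume t: "t \<in> {a..b}" and wR: "\<And>r. r \<in> {a..t} \<Longrightarrow> norm (w r) \<le> R"
    have x: "\<sigma>_w (norm (x r)) \<le> \<alpha>_w R" if r: "r \<in> {a..t}" for r
    proof -
      have \<alpha>R: "0 \<le> \<alpha>_w R" using Rpos K_infinity_nonneg[OF K_functions(3)] by simp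
      have "V_q (x r) \<le> V_q (x a) - al_w (norm (w r))"
        by (rule decrease_of_small_error[OF R]) (use r t wR in auto)
      then have "al_q (norm (x r)) \<le> al_q (K_inv \<sigma>_w (\<alpha>_w R))"
        using start V_q_bounds(1)[of "x r"] K_infinity_nonneg[OF K_functions(1), of "norm (w r)"] by simp
      then have "norm (x r) \<le> K_inv \<sigma>_w (\<alpha>_w R)"
        using K_inv_nonneg[OF K_functions(4) \<alpha>R] by (simp add: K_infinity_le_iff[OF K_functions(5)])
      then show ?thesis using \<alpha>R by (simp add: le_K_inv_iff[OF K_functions(4)])
    qed
    \<comment> \<open>With weights 0 and 1 only U is tracked. On the sublevel set its two growth
      terms are each at most \<open>\<alpha>_w R\<close>, and
      \<open>\<alpha>_w R \<le> \<gamma> R\<close> brings in the bound on the interval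
      length.\<close>
    have "0 * (V_q (x t) - V_q (x a)) + 1 * (U (w t) - U (w a)) \<le> (2 * \<alpha>_w R) * (t - a)"
    proof (rule increment_bound)
      fix r assume r: "r \<in> {a..t}"
      show "0 * (- \<alpha>_q (norm (x r)) + \<sigma>_q (norm (w r)))
          + 1 * (\<alpha>_w (norm (w r)) + \<sigma>_w (norm (x r))) \<le> 2 * \<alpha>_w R"
        using x[OF r] K_infinity_mono[OF K_functions(3) norm_ge_zero wR[OF r]] by simp
    qed (use t in auto)
    then have "U (w t) \<le> 2 * \<alpha>_w R * (t - a)" by (simp add: w_start U_zero)
    also have "\<dots> \<le> 2 * \<gamma> R * (b - a)"
      using t \<gamma>_dom'[of R] Rpos K_infinity_nonneg[OF K_functions(8), of R]
        K_infinity_nonneg[OF K_functions(3), of R]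
      by (intro mult_mono) auto
    also have "\<dots> < al_w R" using R[OF Rpos] by (simp add: mult.commute mult.left_commute)
    finally have "al_w (norm (w t)) < al_w R" using U_bounds(1)[of "w t"] by simp
    then show "norm (w t) < R" using Rpos K_functions by (simp add: K_infinity_less_iff)
  qed
  show "norm (w t) \<le> R" using nt[OF t] by simp
  show "V_q (x t) \<le> V_q (x a) - al_w (norm (w s))" if "s \<in> {a..t}"
    by (rule decrease_of_small_error[OF R t _ that]) (use nt t in \<open>auto intro!: less_imp_le\<close>)
qed

end

section \<open>Solutions starting at the origin\<close>

context iss_sampled_loop
begin

lemma K_inv_\<sigma>_\<alpha>_nonneg: "0 \<le> R \<Longrightarrow> 0 \<le> K_inv \<sigma>_w (\<alpha>_w R)"
  by (rule K_inv_nonneg[OF K_functions(4) K_infinity_nonneg[OF K_functions(3)]])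

text \<open>A finite upper limit of \<open>\<gamma> / al_w\<close> bounds the quotient by some C
  near zero, and then \<open>\<tau> = 1 / (2 C)\<close> is short enough.\<close>

lemma small_gain_near_zero:
  obtains \<tau> R where "\<tau> > 0" "R > 0" "\<And>s. 0 < s \<Longrightarrow> s \<le> R \<Longrightarrow> 2 * \<tau> * \<gamma> s < al_w s"
proof -
  obtain C :: nat where "Limsup (at_right 0) (\<lambda>s. ereal (\<gamma> s / al_w s)) < ereal (real C)"
    using \<gamma>_O unfolding O_at_zero_def by (auto simp: less_PInf_Ex_of_nat)
  then have "\<forall>\<^sub>F s in at_right 0. ereal (\<gamma> s / al_w s) < ereal (real C)"
    by (rule Limsup_lessD)
  then obtain b :: real where b: "b > 0" "\<And>s. 0 < s \<Longrightarrow> s < b \<Longrightarrow> \<gamma> s / al_w s < C"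
    by (auto simp: eventually_at_right_field)
  \<comment> \<open>The maximum with 1 makes the divisor positive; \<open>b / 2\<close> below turns
    the open range of arguments into a closed one.\<close>
  define C' where "C' = max (real C) 1"
  have "2 * (1 / (2 * C')) * \<gamma> s < al_w s" if "0 < s" "s \<le> b / 2" for s
  proof -
    have "\<gamma> s / al_w s < C'" using b that by (fastforce simp: C'_def)
    then show ?thesis
      using K_infinity_pos[OF K_functions(1) that(1)] by (simp add: C'_def field_simps)
  qed
  then show thesis using that[of "1 / (2 * C')" "b / 2"] b(1) by (auto simp: C'_def)
qed

text \<open>If \<open>R0 = 0\<close>, the condition on the period is void, and only the growth condition
  \<open>O_at_zero \<gamma> al_w\<close> shows that a solution stays at the origin: the estimate applies on pieces of some
  short length \<open>\<tau>\<close>, and since the state is still zero at their end points, resampling there does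
  not change the input.\<close>

lemma held_solution_from_zero:
  assumes d: "\<And>r. r \<in> {a..b} \<Longrightarrow> d r \<in> D" and sol: "held_solution f (K 0) d a b x"
    and a: "x a = 0" and s: "s \<in> {a..b}"
  shows "x s = 0"
proof -
  obtain \<tau> R where \<tau>: "\<tau> > 0" "R > 0" "\<And>s. 0 < s \<Longrightarrow> s \<le> R \<Longrightarrow> 2 * \<tau> * \<gamma> s < al_w s"
    using small_gain_near_zero by metis
  have "x s = 0" if "s \<in> {a..b}" "s \<le> a + real n * \<tau>" for n s
    using that
  proof (induction n arbitrary: s)
    case 0
    then show ?case using a by (simp add: order_antisym)
  next
    case (Suc n)
    define a' where "a' = a + real n * \<tau>"
    show ?case
    proof (cases "s \<le> a'")
      case True
      then show ?thesis using Suc by (simp add: a'_def)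
    next
      case False
      have aa': "a \<le> a'" using \<tau> by (simp add: a'_def)
      have a'0: "x a' = 0" using Suc.IH[of a'] Suc.prems False aa' by (simp add: a'_def)
      interpret I: held_interval f h \<kappa> D V_q U al_w au_w \<alpha>_w \<sigma>_w al_q au_q \<alpha>_q \<sigma>_q \<gamma> d a' s x
      proof unfold_locales
        show "held_solution f (K (x a')) d a' s x"
          unfolding a'0 using held_solution_subinterval[OF sol aa'] Suc.prems by simp
      qed (use False d aa' Suc.prems in auto)
      have sa: "s - a' \<le> \<tau>" using Suc.prems by (simp add: a'_def algebra_simps)
      have "V_q (x s) \<le> V_q (x a') - al_w (norm (I.w s))"
      proof (rule I.interval_estimate_pos(2)[OF \<tau>(2)])
        fix r :: real assume r: "0 < r" "r \<le> R"
        have "2 * (s - a') * \<gamma> r \<le> 2 * \<tau> * \<gamma> r"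
          using sa r K_infinity_nonneg[OF \<gamma>, of r] by (intro mult_right_mono) auto
        then show "2 * (s - a') * \<gamma> r < al_w r" using \<tau>(3)[OF r] by simp
      next
        have "V_q (x a') \<le> 0" using a'0 V_q_le_zero_iff by simp
        also have "0 \<le> al_q (K_inv \<sigma>_w (\<alpha>_w R))"
          using \<tau>(2) by (intro K_infinity_nonneg[OF K_functions(5)] K_inv_\<sigma>_\<alpha>_nonneg) simp
        finally show "V_q (x a') \<le> al_q (K_inv \<sigma>_w (\<alpha>_w R))" .
      qed (use False in auto)
      also have "\<dots> \<le> 0"
        using a'0 V_q_le_zero_iff[of 0] K_infinity_nonneg[OF K_functions(1), of "norm (I.w s)"] by simp
      finally show ?thesis by (simp add: V_q_le_zero_iff)
    qed
  qed
  moreover obtain n :: nat where "(s - a) / \<tau> \<le> real n" using real_arch_simple by blast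
  then have "s \<le> a + real n * \<tau>" using \<tau>(1) by (simp add: field_simps)
  ultimately show ?thesis using s by blast
qed

end

section \<open>Periodic sampling\<close>

locale periodic_loop =
  iss_sampled_loop f h \<kappa> D V_q U al_w au_w \<alpha>_w \<sigma>_w al_q au_q \<alpha>_q \<sigma>_q \<gamma>
  for f :: "real^'n \<Rightarrow> real^'m \<Rightarrow> real^'e \<Rightarrow> real^'n"
    and h :: "real^'n \<Rightarrow> real^'q"
    and \<kappa> D V_q U al_w au_w \<alpha>_w \<sigma>_w al_q au_q \<alpha>_q \<sigma>_q \<gamma> +
  fixes R0 T :: real and t :: "nat \<Rightarrow> real"
  assumes R0_nonneg: "R0 \<ge> 0" and T: "T > 0" and t_Suc: "\<And>k. t (Suc k) = t k + T"
    and period: "\<And>s. 0 < s \<Longrightarrow> s \<le> R0 \<Longrightarrow> 2 * T * \<gamma> s < al_w s"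
begin

definition S where "S = {x. V_q x \<le> al_q (K_inv \<sigma>_w (\<alpha>_w R0))}"

lemma interval_estimate:
  assumes ab: "a \<le> b" "b \<le> a + T" and d: "\<And>r. r \<in> {a..b} \<Longrightarrow> d r \<in> D"
    and sol: "held_solution f (K (x a)) d a b x" and start: "x a \<in> S" and s: "s \<in> {a..b}"
  shows "norm (K (x a) - K (x s)) \<le> R0"
    and "r \<in> {a..s} \<Longrightarrow> V_q (x s) \<le> V_q (x a) - al_w (norm (K (x a) - K (x r)))"
proof -
  interpret I: held_interval f h \<kappa> D V_q U al_w au_w \<alpha>_w \<sigma>_w al_q au_q \<alpha>_q \<sigma>_q \<gamma> d a b x
    by unfold_locales (use assms in auto)
  have "norm (K (x a) - K (x s)) \<le> R0 \<and>
    (\<forall>r\<in>{a..s}. V_q (x s) \<le> V_q (x a) - al_w (norm (K (x a) - K (x r))))"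
  proof (cases "R0 = 0")
    \<comment> \<open>S is the single point 0 here, so the claim reduces to the solution staying at
      the origin.\<close>
    case True
    have "V_q (x a) \<le> 0"
      using start[unfolded S_def] True K_inv_left[OF K_functions(4), of 0] K_functions
      by (simp add: K_infinity_zero)
    then have a0: "x a = 0" by (simp add: V_q_le_zero_iff)
    have "x r = 0" if "r \<in> {a..b}" for r
      using held_solution_from_zero[OF d] sol a0 that by simp
    then show ?thesis using a0 s True K_functions by (simp add: K_infinity_zero)
  next
    case False
    then have R0: "R0 > 0" using R0_nonneg by simp
    have small: "2 * (b - a) * \<gamma> r < al_w r" if r: "0 < r" "r \<le> R0" for r
    proof -
      have "2 * (b - a) * \<gamma> r \<le> 2 * T * \<gamma> r"
        using ab r K_infinity_nonneg[OF \<gamma>, of r] by (intro mult_right_mono) auto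
      then show ?thesis using period[OF r] by simp
    qed
    show ?thesis
      using I.interval_estimate_pos[OF R0 small _ s] start unfolding S_def I.w_def by auto
  qed
  then show "norm (K (x a) - K (x s)) \<le> R0"
    and "r \<in> {a..s} \<Longrightarrow> V_q (x s) \<le> V_q (x a) - al_w (norm (K (x a) - K (x r)))"
    by auto
qed

lemma t_mono: "j \<le> k \<Longrightarrow> t j \<le> t k"
  by (rule lift_Suc_mono_le[of t]) (use t_Suc T in auto)

lemma t_eq: "t k = t 0 + real k * T"
  by (induction k) (auto simp: t_Suc algebra_simps)

lemma sample_interval:
  assumes "t 0 \<le> s"
  obtains k where "t k \<le> s" "s < t (Suc k)"
proof
  define k where "k = nat \<lfloor>(s - t 0) / T\<rfloor>"
  have q: "0 \<le> (s - t 0) / T" using assms T by simp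
  have "real k \<le> (s - t 0) / T" unfolding k_def using q by (simp add: of_nat_nat)
  then show "t k \<le> s" using T unfolding t_eq[of k] by (simp add: field_simps)
  have "(s - t 0) / T < real (Suc k)" unfolding k_def using q by (simp add: of_nat_nat) linarith
  then show "s < t (Suc k)" using T unfolding t_eq[of "Suc k"] by (simp add: field_simps)
qed

lemma sample_interval_unique:
  assumes "t k \<le> s" "s < t (Suc k)" "t j \<le> s" "s < t (Suc j)"
  shows "j = k"
proof -
  have "k < Suc j" using t_mono[of "Suc j" k] assms by (meson not_less less_le_trans leD)
  moreover have "j < Suc k" using t_mono[of "Suc k" j] assms by (meson not_less less_le_trans leD)
  ultimately show ?thesis by simp
qed

lemma sampled_solution_held:
  assumes "sampled_solution f h \<kappa> t d b x" "s \<le> t (Suc k)" "ereal s < b"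
  shows "held_solution f (K (x (t k))) d (t k) s x"
  unfolding held_solution_def
proof
  fix s' assume s': "s' \<in> {t k..s}"
  then have "ereal s' < b" using assms(3) le_less_trans[of "ereal s'" "ereal s" b] by simp
  then show "((\<lambda>r. f (x r) (K (x (t k))) (d r)) has_integral (x s' - x (t k))) {t k..s'}"
    using assms(1,2) s' unfolding sampled_solution_def by simp
qed

section \<open>Estimates for sampled solutions started in S\<close>

context
  fixes d b x
  assumes d: "uncertainty D (t 0) d" and sol: "sampled_solution f h \<kappa> t d b x"
    and start: "x (t 0) \<in> S"
begin

lemma d_in: "t k \<le> r \<Longrightarrow> d r \<in> D"
  using d t_mono[of 0 k] by (auto simp: uncertainty_def)

lemma V_q_samples_le:
  "ereal (t k) < b \<Longrightarrow> V_q (x (t k)) \<le> V_q (x (t 0)) \<and> x (t k) \<in> S"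
proof (induction k)
  case 0
  then show ?case using start by simp
next
  case (Suc k)
  have le: "t k \<le> t (Suc k)" using T by (simp add: t_Suc)
  then have IH: "V_q (x (t k)) \<le> V_q (x (t 0))" "x (t k) \<in> S"
    using Suc le_less_trans[of "ereal (t k)" "ereal (t (Suc k))" b] by auto
  have "V_q (x (t (Suc k))) \<le> V_q (x (t k)) - al_w (norm (K (x (t k)) - K (x (t k))))"
    by (rule interval_estimate(2)[of "t k" "t (Suc k)" d])
      (use le T IH d_in sampled_solution_held[OF sol _ Suc.prems] in \<open>auto simp: t_Suc\<close>)
  then show ?case using IH start K_functions by (simp add: K_infinity_zero S_def)
qed

lemma sampled_interval_estimate:
  assumes s: "t k \<le> s" "s \<le> t (Suc k)" "ereal s < b"
  shows "norm (K (x (t k)) - K (x s)) \<le> R0"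
    and "t k \<le> r \<Longrightarrow> r \<le> s \<Longrightarrow> V_q (x s) \<le> V_q (x (t k)) - al_w (norm (K (x (t k)) - K (x r)))"
    and "V_q (x s) \<le> V_q (x (t k))" and "V_q (x (t k)) \<le> V_q (x (t 0))"
proof -
  have tk: "ereal (t k) < b" using s le_less_trans[of "ereal (t k)" "ereal s" b] by simp
  note hyps = s(1) _ _ sampled_solution_held[OF sol s(2,3)] conjunct2[OF V_q_samples_le[OF tk]]
  show "norm (K (x (t k)) - K (x s)) \<le> R0"
    by (rule interval_estimate(1)[OF hyps]) (use s d_in t_Suc in auto)
  show *: "V_q (x s) \<le> V_q (x (t k)) - al_w (norm (K (x (t k)) - K (x r)))"
    if "t k \<le> r" "r \<le> s" for r
    by (rule interval_estimate(2)[OF hyps]) (use s d_in t_Suc that in auto)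
  show "V_q (x s) \<le> V_q (x (t k))"
    using *[of "t k"] s K_functions by (simp add: K_infinity_zero)
  show "V_q (x (t k)) \<le> V_q (x (t 0))" using V_q_samples_le[OF tk] by simp
qed

lemma V_q_le_start:
  assumes "t 0 \<le> s" "ereal s < b"
  shows "V_q (x s) \<le> V_q (x (t 0))"
proof -
  obtain k where "t k \<le> s" "s < t (Suc k)" using sample_interval[OF assms(1)] .
  then show ?thesis using sampled_interval_estimate(3,4)[of k s] assms(2) by simp
qed

lemma stays_in_S: "t 0 \<le> s \<Longrightarrow> ereal s < b \<Longrightarrow> x s \<in> S"
  using V_q_le_start[of s] start by (simp add: S_def)

lemma sampling_error_bound:
  assumes "t 0 \<le> s" "ereal s < b"
  shows "norm (sampling_error h \<kappa> t x s) \<le> R0"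
proof -
  obtain k where k: "t k \<le> s" "s < t (Suc k)" using sample_interval[OF assms(1)] .
  then have "(THE k. s \<in> {t k..<t (Suc k)}) = k"
    using sample_interval_unique by (intro the_equality) auto
  then show ?thesis
    using sampled_interval_estimate(1)[of k s] k assms(2) by (simp add: sampling_error_def)
qed

end

section \<open>Global existence of sampled solutions\<close>

lemma norm_bound_in_S:
  assumes "x \<in> S"
  shows "norm x \<le> K_inv \<sigma>_w (\<alpha>_w R0)"
proof -
  have "al_q (norm x) \<le> al_q (K_inv \<sigma>_w (\<alpha>_w R0))"
    using assms V_q_bounds(1)[of x] by (simp add: S_def)
  moreover have "0 \<le> K_inv \<sigma>_w (\<alpha>_w R0)"
    using R0_nonneg by (rule K_inv_\<sigma>_\<alpha>_nonneg)
  ultimately show ?thesis by (simp add: K_infinity_le_iff[OF K_functions(5)])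
qed

text \<open>The truncated equation is globally Lipschitz; its solution never reaches the truncation radius
  because up to that time it solves the original equation, so the invariance of \<open>S\<close> applies.\<close>

lemma held_solution_exists:
  assumes d: "uncertainty D (t 0) d" and a: "t 0 \<le> a" and x0: "x0 \<in> S"
  obtains y where "y a = x0" "held_solution f (K x0) d a (a + T) y" "y (a + T) \<in> S"
proof -
  define B where "B = K_inv \<sigma>_w (\<alpha>_w R0)"
  \<comment> \<open>States in S have norm at most B; the extra 1 leaves the strict margin that the
    barrier argument needs.\<close>
  let ?P = "closest_point (cball (0::real^'n) (B + 1))"
  have B0: "0 \<le> B"
    unfolding B_def using R0_nonneg by (rule K_inv_\<sigma>_\<alpha>_nonneg)
  have dD: "d r \<in> D" if "a \<le> r" for r using d a that by (simp add: uncertainty_def)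
  have "d \<in> borel_measurable (lebesgue_on {a..a+T})"
    using d a unfolding uncertainty_def
    by (auto intro: measurable_restrict_mono)
  then obtain y where y: "y a = x0" "held_solution (\<lambda>x. f (?P x)) (K x0) d a (a + T) y"
    using truncated_held_solution_exists[OF f D, of a "a + T" "B + 1" d x0 "K x0"] T B0 dD by auto
  have untruncate: "held_solution f (K (y a)) d a s y"
    if s: "s \<in> {a..a+T}" and bd: "\<And>r. r \<in> {a..s} \<Longrightarrow> norm (y r) \<le> B + 1" for s
    unfolding held_solution_def
  proof
    fix s' assume s': "s' \<in> {a..s}"
    have "((\<lambda>r. f (?P (y r)) (K x0) (d r)) has_integral y s' - y a) {a..s'}"
      using y(2) s s' unfolding held_solution_def by auto
    then show "((\<lambda>r. f (y r) (K (y a)) (d r)) has_integral y s' - y a) {a..s'}"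
      by (rule has_integral_eq[rotated]) (use y(1) bd s' in \<open>auto simp: closest_point_self\<close>)
  qed
  have inS: "y s \<in> S"
    if s: "s \<in> {a..a+T}" and bd: "\<And>r. r \<in> {a..s} \<Longrightarrow> norm (y r) \<le> B + 1" for s
  proof -
    have "V_q (y s) \<le> V_q (y a) - al_w (norm (K (y a) - K (y a)))"
      by (rule interval_estimate(2)[of a s d, OF _ _ _ untruncate[OF s bd]])
        (use s dD x0 y(1) in auto)
    then show ?thesis using x0 y(1) K_functions by (simp add: S_def K_infinity_zero)
  qed
  have bound: "norm (y s) < B + 1" if "s \<in> {a..a+T}" for s
  proof (rule first_exit_barrier[of a "a + T" "\<lambda>s. norm (y s)", OF _ _ _ that])
    show "continuous_on {a..a+T} (\<lambda>s. norm (y s))"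
      by (intro continuous_on_norm held_solution_continuous[OF y(2)])
    show "norm (y a) < B + 1" using norm_bound_in_S[OF x0] y(1) by (simp add: B_def)
    show "norm (y s) < B + 1"
      if "s \<in> {a..a+T}" "\<And>r. r \<in> {a..s} \<Longrightarrow> norm (y r) \<le> B + 1" for s
      using norm_bound_in_S[OF inS[OF that]] by (simp add: B_def)
  qed
  show thesis
  proof
    show "y a = x0" by (rule y(1))
    show "held_solution f (K x0) d a (a + T) y"
      using untruncate[of "a + T"] bound T y(1) by (auto intro: less_imp_le)
    show "y (a + T) \<in> S" using inS[of "a + T"] bound T by (auto intro: less_imp_le)
  qed
qed

lemma sampled_solution_exists:
  assumes d: "uncertainty D (t 0) d" and x0: "x0 \<in> S"
  obtains x where "x (t 0) = x0" "sampled_solution f h \<kappa> t d \<infinity> x"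
proof -
  \<comment> \<open>Membership of the end value in S is part of the invariant because the next piece
    starts there; the clause for k = 0 pins the initial state.\<close>
  define P where "P k y \<longleftrightarrow> y (t k) \<in> S \<and> y (t (Suc k)) \<in> S \<and> (k = 0 \<longrightarrow> y (t 0) = x0)
      \<and> held_solution f (K (y (t k))) d (t k) (t (Suc k)) y" for k and y :: "real \<Rightarrow> real^'n"
  have step: "\<exists>y. y (t k) = z \<and> y (t (Suc k)) \<in> S \<and> held_solution f (K z) d (t k) (t (Suc k)) y"
    if "z \<in> S" for z k
    using held_solution_exists[OF d _ that, of "t k"] t_mono[of 0 k] t_Suc by (metis le0)
  have "\<exists>Y. \<forall>k. P k (Y k) \<and> Y (Suc k) (t (Suc k)) = Y k (t (Suc k))"
  proof (rule dependent_nat_choice)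
    show "\<exists>y. P 0 y" using step[OF x0, of 0] x0 unfolding P_def by auto
    show "\<exists>y'. P (Suc k) y' \<and> y' (t (Suc k)) = y (t (Suc k))" if "P k y" for y k
    proof -
      obtain y' where "y' (t (Suc k)) = y (t (Suc k))" "y' (t (Suc (Suc k))) \<in> S"
          "held_solution f (K (y (t (Suc k)))) d (t (Suc k)) (t (Suc (Suc k))) y'"
        using step[of "y (t (Suc k))" "Suc k"] \<open>P k y\<close> unfolding P_def by auto
      then show ?thesis using \<open>P k y\<close> unfolding P_def by (intro exI[of _ y']) simp
    qed
  qed
  then obtain Y where Y: "\<And>k. P k (Y k)" "\<And>k. Y (Suc k) (t (Suc k)) = Y k (t (Suc k))" by blast
  define x where "x s = Y (THE k. t k \<le> s \<and> s < t (Suc k)) s" for s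
  have x: "x s = Y k s" if "t k \<le> s" "s < t (Suc k)" for k s
  proof -
    have "(THE k. t k \<le> s \<and> s < t (Suc k)) = k"
      using that sample_interval_unique by (intro the_equality) auto
    then show ?thesis by (simp add: x_def)
  qed
  have t_less: "t k < t (Suc k)" for k using T by (simp add: t_Suc)
  \<comment> \<open>Agreement at the right end comes from the matching of consecutive pieces; the
    integral equation is required up to and including \<open>t (Suc k)\<close>.\<close>
  have x': "x s = Y k s" if "s \<in> {t k..t (Suc k)}" for k s
    using that x[of k s] x[of "Suc k" s] Y(2)[of k] t_less[of "Suc k"]
    by (cases "s = t (Suc k)") auto
  show thesis
  proof
    show "x (t 0) = x0" using x'[of "t 0" 0] Y(1)[of 0] t_less[of 0] by (simp add: P_def)
    show "sampled_solution f h \<kappa> t d \<infinity> x"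
      unfolding sampled_solution_def
    proof (intro allI impI)
      fix k s assume s: "t k \<le> s \<and> s \<le> t (Suc k) \<and> ereal s < \<infinity>"
      have "((\<lambda>r. f (Y k r) (K (Y k (t k))) (d r)) has_integral (Y k s - Y k (t k))) {t k..s}"
        using Y(1)[of k] s unfolding P_def held_solution_def by auto
      then have "((\<lambda>r. f (Y k r) (K (Y k (t k))) (d r)) has_integral (x s - x (t k))) {t k..s}"
        using x'[of _ k] s t_less[of k] by auto
      then show "((\<lambda>r. f (x r) (\<kappa> (h (x (t k)))) (d r)) has_integral (x s - x (t k))) {t k..s}"
        by (rule has_integral_eq[rotated]) (use x'[of _ k] s t_less[of k] in auto)
    qed
  qed
qed

end

section \<open>Convergence and stability\<close>

context periodic_loop
begin

lemma norm_less_of_V_q_less: "V_q x < al_q e \<Longrightarrow> 0 \<le> e \<Longrightarrow> norm x < e"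
  using V_q_bounds(1)[of x] K_infinity_less_iff[OF K_functions(5), of "norm x" e] by simp

lemma sampled_solution_converges:
  assumes d: "uncertainty D (t 0) d" and sol: "sampled_solution f h \<kappa> t d \<infinity> x"
    and start: "x (t 0) \<in> S"
  shows "(x \<longlongrightarrow> 0) at_top"
proof -
  define v where "v k = V_q (x (t k))" for k
  note est = sampled_interval_estimate[OF d sol start]
  have dec: "v (Suc k) \<le> v k" for k
    unfolding v_def using est(3)[of k "t (Suc k)"] T by (simp add: t_Suc)
  then have "decseq v" by (rule decseq_SucI)
  moreover have v0: "0 \<le> v k" for k by (simp add: v_def V_q_nonneg)
  ultimately obtain l where l: "v \<longlonglongrightarrow> l" "\<And>k. l \<le> v k"
    using decseq_convergent[of v 0] by metis
  have l0: "0 \<le> l" using LIMSEQ_le_const[OF l(1)] v0 by blast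
  have "l = 0"
  proof (rule ccontr)
    assume "l \<noteq> 0"
    then have lpos: "l > 0" using l0 by simp
    \<comment> \<open>Where \<open>V_q \<ge> l / 2\<close>, the upper bound \<open>au_q\<close>
      forces the state to have norm at least \<open>\<rho>\<close>, and then \<open>V_q\<close>
      decays at rate c up to the error term.\<close>
    define \<rho> where "\<rho> = K_inv au_q (l / 2)"
    have au\<rho>: "au_q \<rho> = l / 2" unfolding \<rho>_def using lpos K_functions by (intro K_inv_right) auto
    have \<rho>0: "0 \<le> \<rho>" unfolding \<rho>_def using lpos K_functions by (intro K_inv_nonneg) auto
    have "\<rho> \<noteq> 0" using au\<rho> lpos K_infinity_zero[OF K_functions(6)] by auto
    then have \<rho>: "\<rho> > 0" using \<rho>0 by simp
    define c where "c = \<alpha>_q \<rho>"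
    have c: "c > 0" unfolding c_def by (rule K_infinity_pos[OF K_functions(7) \<rho>])
    \<comment> \<open>Bound for the error term: \<open>c / 2\<close> leaves half of the decay, and
      \<open>l / (2 * T)\<close> limits the rise of \<open>V_q\<close> within one interval to
      \<open>l / 2\<close>.\<close>
    define \<eta> where "\<eta> = min (c / 2) (l / (2 * T))"
    have \<eta>: "\<eta> > 0" "\<eta> \<le> c / 2" "\<eta> * T \<le> l / 2"
    proof -
      have "\<eta> * T \<le> l / (2 * T) * T" using T by (intro mult_right_mono) (auto simp: \<eta>_def)
      then show "\<eta> * T \<le> l / 2" using T by simp
    qed (use c lpos T in \<open>auto simp: \<eta>_def\<close>)
    define \<mu> where "\<mu> = K_inv \<sigma>_q \<eta>"
    have \<sigma>\<mu>: "\<sigma>_q \<mu> = \<eta>" unfolding \<mu>_def using \<eta> K_functions by (intro K_inv_right) auto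
    have \<mu>0: "0 \<le> \<mu>" unfolding \<mu>_def using \<eta> K_functions by (intro K_inv_nonneg) auto
    have "\<mu> \<noteq> 0" using \<sigma>\<mu> \<eta> K_infinity_zero[OF K_functions(8)] by auto
    then have \<mu>: "\<mu> > 0" using \<mu>0 by simp
    have "(\<lambda>k. v k - v (Suc k)) \<longlonglongrightarrow> l - l"
      by (intro tendsto_diff l(1) LIMSEQ_Suc)
    then have "\<forall>\<^sub>F k in sequentially. v k - v (Suc k) < min (al_w \<mu>) (c * T / 2)"
      using K_infinity_pos[OF K_functions(1) \<mu>] c T by (intro order_tendstoD) auto
    \<comment> \<open>A drop below \<open>al_w \<mu>\<close> keeps every error of this interval
      below \<open>\<mu>\<close>; a drop below \<open>c * T / 2\<close> is what the decay then
      contradicts.\<close>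
    then obtain k where k: "v k - v (Suc k) < al_w \<mu>" "v k - v (Suc k) < c * T / 2"
      by (auto simp: eventually_sequentially)
    have tk: "t k \<le> t (Suc k)" "t (Suc k) - t k = T" using T by (auto simp: t_Suc)
    interpret I: held_interval f h \<kappa> D V_q U al_w au_w \<alpha>_w \<sigma>_w al_q au_q \<alpha>_q \<sigma>_q \<gamma> d "t k" "t (Suc k)" x
      by unfold_locales (use tk d_in[OF d sol start] sampled_solution_held[OF sol] in auto)
    have w: "\<sigma>_q (norm (I.w r)) \<le> \<eta>" if r: "r \<in> {t k..t (Suc k)}" for r
    proof -
      have "al_w (norm (I.w r)) < al_w \<mu>"
        using est(2)[of k "t (Suc k)" r] tk r k(1) by (simp add: v_def I.w_def)
      then have "norm (I.w r) \<le> \<mu>"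
        using \<mu> by (simp add: K_infinity_less_iff[OF K_functions(1)])
      then show ?thesis using K_infinity_mono[OF K_functions(8), of "norm (I.w r)" \<mu>] \<sigma>\<mu> by simp
    qed
    \<comment> \<open>The argument runs backwards from the right end, where
      \<open>V_q \<ge> l\<close>: a rise of at most \<open>l / 2\<close> up to there leaves at least
      \<open>l / 2\<close> at the time r.\<close>
    have x: "\<rho> \<le> norm (x r)" if r: "r \<in> {t k..t (Suc k)}" for r
    proof -
      have "1 * (V_q (x (t (Suc k))) - V_q (x r)) + 0 * (U (I.w (t (Suc k))) - U (I.w r))
          \<le> \<eta> * (t (Suc k) - r)"
      proof (rule I.increment_bound)
        fix q assume "q \<in> {r..t (Suc k)}"
        then have "q \<in> {t k..t (Suc k)}" using r by auto
        from w[OF this] show "1 * (- \<alpha>_q (norm (x q)) + \<sigma>_q (norm (I.w q)))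
            + 0 * (\<alpha>_w (norm (I.w q)) + \<sigma>_w (norm (x q))) \<le> \<eta>"
          using K_infinity_nonneg[OF K_functions(7), of "norm (x q)"] by simp
      qed (use r in auto)
      also have "\<eta> * (t (Suc k) - r) \<le> \<eta> * T"
        using r tk \<eta> by (intro mult_left_mono) auto
      finally have "l / 2 \<le> V_q (x r)" using \<eta>(3) l(2)[of "Suc k"] by (simp add: v_def)
      then have "au_q \<rho> \<le> au_q (norm (x r))" using V_q_bounds(2)[of "x r"] au\<rho> by simp
      then show ?thesis using \<rho>0 by (simp add: K_infinity_le_iff[OF K_functions(6)])
    qed
    have "1 * (V_q (x (t (Suc k))) - V_q (x (t k))) + 0 * (U (I.w (t (Suc k))) - U (I.w (t k)))
        \<le> (- c / 2) * (t (Suc k) - t k)"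
    proof (rule I.increment_bound)
      fix r assume r: "r \<in> {t k..t (Suc k)}"
      have "c \<le> \<alpha>_q (norm (x r))" unfolding c_def by (rule K_infinity_mono[OF K_functions(7) \<rho>0 x[OF r]])
      then show "1 * (- \<alpha>_q (norm (x r)) + \<sigma>_q (norm (I.w r)))
          + 0 * (\<alpha>_w (norm (I.w r)) + \<sigma>_w (norm (x r))) \<le> - c / 2"
        using w[OF r] \<eta>(2) by simp
    qed (use tk in auto)
    then have "v (Suc k) - v k \<le> - c * T / 2" using tk by (simp add: v_def)
    then show False using k(2) by simp
  qed
  show ?thesis
  proof (rule tendstoI)
    fix e :: real assume e: "e > 0"
    have "\<forall>\<^sub>F k in sequentially. v k < al_q e"
      using l(1) \<open>l = 0\<close> K_infinity_pos[OF K_functions(5) e] by (intro order_tendstoD) auto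
    then obtain k where k: "v k < al_q e" by (auto simp: eventually_sequentially)
    have "dist (x s) 0 < e" if s: "t k \<le> s" for s
    proof -
      have "t 0 \<le> s" using s t_mono[of 0 k] by simp
      then obtain j where j: "t j \<le> s" "s < t (Suc j)" using sample_interval by blast
      have "k \<le> j"
      proof (rule ccontr)
        assume "\<not> k \<le> j"
        then show False using t_mono[of "Suc j" k] j s by simp
      qed
      have "V_q (x s) \<le> v j" unfolding v_def using est(3)[of j s] j by simp
      also have "\<dots> \<le> v k" using \<open>decseq v\<close> \<open>k \<le> j\<close> by (rule decseqD)
      finally show ?thesis using norm_less_of_V_q_less[of "x s" e] k e by simp
    qed
    then show "\<forall>\<^sub>F s in at_top. dist (x s) 0 < e"
      by (auto simp: eventually_at_top_linorder)
  qed
qed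

lemma asymptotically_stable_from_subset:
  assumes "M \<subseteq> S"
  shows "asymptotically_stable_from f h \<kappa> D t M"
  unfolding asymptotically_stable_from_def
proof (intro conjI allI impI ballI)
  fix d x0 assume "uncertainty D (t 0) d" "x0 \<in> M"
  then show "\<exists>x. x (t 0) = x0 \<and> sampled_solution f h \<kappa> t d \<infinity> x"
    using sampled_solution_exists[of d x0] assms by blast
next
  fix e :: real assume e: "e > 0"
  have al: "al_q e > 0" by (rule K_infinity_pos[OF K_functions(5) e])
  \<comment> \<open>From \<open>norm x < \<delta>\<close> follows \<open>V_q x < al_q e\<close>, and
    no solution leaves that sublevel set upwards in \<open>V_q\<close>.\<close>
  define \<delta> where "\<delta> = K_inv au_q (al_q e)"
  have \<delta>: "0 \<le> \<delta>" "au_q \<delta> = al_q e"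
    unfolding \<delta>_def using al K_functions by (auto intro: K_inv_nonneg K_inv_right)
  have "\<delta> \<noteq> 0" using \<delta> al K_infinity_zero[OF K_functions(6)] by auto
  then have "\<delta> > 0" using \<delta> by simp
  moreover have "norm (x s) < e"
    if d: "uncertainty D (t 0) d" and sol: "sampled_solution f h \<kappa> t d b x" and x0: "x (t 0) \<in> M"
      "norm (x (t 0)) < \<delta>" and s: "t 0 \<le> s" "ereal s < b" for d b x s
  proof (rule norm_less_of_V_q_less)
    have "V_q (x s) \<le> V_q (x (t 0))"
      using x0(1) assms by (intro V_q_le_start[OF d sol _ s]) auto
    also have "\<dots> \<le> au_q (norm (x (t 0)))" by (rule V_q_bounds)
    also have "\<dots> < al_q e"
      using x0(2) \<delta> K_infinity_less_iff[OF K_functions(6), of "norm (x (t 0))" \<delta>] by simp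
    finally show "V_q (x s) < al_q e" .
  qed (use e in simp)
  ultimately show "\<exists>\<delta>>0. \<forall>d b x. uncertainty D (t 0) d \<and> sampled_solution f h \<kappa> t d b x \<and>
      x (t 0) \<in> M \<and> norm (x (t 0)) < \<delta> \<longrightarrow> (\<forall>s\<ge>t 0. ereal s < b \<longrightarrow> norm (x s) < e)"
    by blast
next
  fix d x
  assume "uncertainty D (t 0) d \<and> sampled_solution f h \<kappa> t d \<infinity> x \<and> x (t 0) \<in> M"
  then show "(x \<longlongrightarrow> 0) at_top" using assms by (intro sampled_solution_converges) auto
qed

text \<open>X need not surround the origin, so local asymptotic stability in the usual sense is
  obtained on a ball inside S.\<close>

lemma ball_subset_S:
  assumes "R0 > 0"
  obtains r where "r > 0" "ball 0 r \<subseteq> S"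
proof
  define c where "c = al_q (K_inv \<sigma>_w (\<alpha>_w R0))"
  have \<alpha>R: "\<alpha>_w R0 > 0" by (rule K_infinity_pos[OF K_functions(3) assms])
  have "K_inv \<sigma>_w (\<alpha>_w R0) \<noteq> 0"
    using K_inv_right[OF K_functions(4), of "\<alpha>_w R0"] \<alpha>R K_infinity_zero[OF K_functions(4)] by auto
  then have c: "c > 0"
    unfolding c_def using K_inv_\<sigma>_\<alpha>_nonneg[OF R0_nonneg] by (intro K_infinity_pos[OF K_functions(5)]) simp
  have au: "au_q (K_inv au_q c) = c" using c by (intro K_inv_right K_functions) simp
  have nn: "0 \<le> K_inv au_q c" using c by (intro K_inv_nonneg K_functions) simp
  have "K_inv au_q c \<noteq> 0" using au c K_infinity_zero[OF K_functions(6)] by auto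
  then show "K_inv au_q c > 0" using nn by simp
  show "ball 0 (K_inv au_q c) \<subseteq> S"
  proof
    fix x :: "real^'n" assume "x \<in> ball 0 (K_inv au_q c)"
    then have "au_q (norm x) \<le> au_q (K_inv au_q c)"
      by (intro K_infinity_mono[OF K_functions(6)]) auto
    then show "x \<in> S" using V_q_bounds(2)[of x] au by (simp add: S_def c_def)
  qed
qed

lemma S_eq_zero: "R0 = 0 \<Longrightarrow> S = {0}"
  unfolding S_def using K_inv_left[OF K_functions(4), of 0] K_functions
  by (auto simp: K_infinity_zero V_q_le_zero_iff)

text \<open>The composition defining R0 inverts the one defining the level of S, so R0 is exactly
  large enough for S to contain X.\<close>

lemma in_S_if:
  assumes "K_inv \<alpha>_w (\<sigma>_w (K_inv al_q (V_q x))) \<le> R0"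
  shows "x \<in> S"
proof -
  have nn: "0 \<le> K_inv al_q (V_q x)" by (rule K_inv_nonneg[OF K_functions(5) V_q_nonneg])
  then have \<sigma>nn: "0 \<le> \<sigma>_w (K_inv al_q (V_q x))" by (rule K_infinity_nonneg[OF K_functions(4)])
  have "\<sigma>_w (K_inv al_q (V_q x)) \<le> \<alpha>_w R0"
    using assms R0_nonneg \<sigma>nn by (simp add: K_inv_le_iff[OF K_functions(3)])
  then have "K_inv al_q (V_q x) \<le> K_inv \<sigma>_w (\<alpha>_w R0)"
    using nn K_infinity_nonneg[OF K_functions(3) R0_nonneg] by (simp add: le_K_inv_iff[OF K_functions(4)])
  then show ?thesis
    using K_inv_\<sigma>_\<alpha>_nonneg[OF R0_nonneg] V_q_nonneg[of x] by (simp add: S_def K_inv_le_iff[OF K_functions(5)])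
qed

end

text \<open>The maximum R0 is expressed as an attained upper bound, so no default value of a
  supremum can enter.\<close>

theorem mainTheorem2:
  fixes f :: "real^'n \<Rightarrow> real^'m \<Rightarrow> real^'e \<Rightarrow> real^'n"
    and h :: "real^'n \<Rightarrow> real^'q"
    and \<kappa> :: "real^'q \<Rightarrow> real^'m"
    and D :: "(real^'e) set"
    and V V_q :: "real^'n \<Rightarrow> real"
    and U :: "real^'m \<Rightarrow> real"
    and al au \<alpha> \<sigma> :: "real \<Rightarrow> real"
    and al_w au_w \<alpha>_w \<sigma>_w :: "real \<Rightarrow> real"
    and al_q au_q \<alpha>_q \<sigma>_q :: "real \<Rightarrow> real"
    and \<alpha>hat_w \<gamma> :: "real \<Rightarrow> real"
    and X S :: "(real^'n) set"
    and R0 T :: real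
    and t :: "nat \<Rightarrow> real"
  assumes D: "compact D"
    and f: "cont_differentiable (\<lambda>(x, u, d). f x u d)" "\<forall>d\<in>D. f 0 0 d = 0"
    and h: "h 0 = 0"
    and \<kappa>: "cont_differentiable \<kappa>" "\<kappa> 0 = 0"
    and \<kappa>h: "(\<kappa> \<circ> h) differentiable_on UNIV"
    and V: "iss_lyapunov D (f_closed f h \<kappa>) V al au \<alpha> \<sigma>"
    and U: "error_growth D (psi_closed f h \<kappa>) U al_w au_w \<alpha>_w \<sigma>_w"
    and \<sigma>_w: "O_at_zero \<sigma>_w \<alpha>"
    and \<alpha>_q: "\<forall>s>0. \<alpha>_q s > 2 * \<sigma>_w s" "O_at_zero \<alpha>_q \<alpha>"
    and V_q: "iss_lyapunov D (f_closed f h \<kappa>) V_q al_q au_q \<alpha>_q \<sigma>_q"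
    and \<alpha>hat_w: "K_infinity \<alpha>hat_w" "\<forall>s>0. \<alpha>hat_w s > \<sigma>_q s / 2"
    and \<gamma>: "K_infinity \<gamma>" "\<forall>s>0. \<gamma> s > \<alpha>hat_w s + \<alpha>_w s" "O_at_zero \<gamma> al_w"
    and X: "compact X" "X \<noteq> {}"
    and R0: "R0 \<in> (K_inv \<alpha>_w \<circ> \<sigma>_w \<circ> K_inv al_q \<circ> V_q) ` closure X"
      "\<forall>x\<in>closure X. (K_inv \<alpha>_w \<circ> \<sigma>_w \<circ> K_inv al_q \<circ> V_q) x \<le> R0"
    and S: "S = {x. V_q x \<le> (al_q \<circ> K_inv \<sigma>_w \<circ> \<alpha>_w) R0}"
    and T: "T > 0" "\<forall>k. t (Suc k) = t k + T"
      "\<forall>s. 0 < s \<and> s \<le> R0 \<longrightarrow> 2 * T * \<gamma> s < al_w s"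
  shows "asymptotically_stable_from f h \<kappa> D t X
    \<and> (X \<noteq> {0} \<longrightarrow> (\<exists>r>0. asymptotically_stable_from f h \<kappa> D t (ball 0 r)))
    \<and> X \<subseteq> S
    \<and> positively_invariant f h \<kappa> D t S
    \<and> (\<forall>d b x. uncertainty D (t 0) d \<and> sampled_solution f h \<kappa> t d b x \<and> x (t 0) \<in> X \<longrightarrow>
          (\<forall>s\<ge>t 0. ereal s < b \<longrightarrow> norm (sampling_error h \<kappa> t x s) \<le> R0))"
proof -
  interpret iss_sampled_loop f h \<kappa> D V_q U al_w au_w \<alpha>_w \<sigma>_w al_q au_q \<alpha>_q \<sigma>_q \<gamma>
  proof
    fix s :: real assume s: "s > 0"
    have "\<alpha>hat_w s > \<sigma>_q s / 2" "\<gamma> s > \<alpha>hat_w s + \<alpha>_w s" using \<alpha>hat_w(2) \<gamma>(2) s by blast+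
    then show "\<sigma>_q s + 2 * \<alpha>_w s \<le> 2 * \<gamma> s" by simp
  qed (use D f \<kappa>h U \<alpha>_q V_q \<gamma> in auto)
  have "R0 \<ge> 0"
  proof -
    obtain x where "R0 = K_inv \<alpha>_w (\<sigma>_w (K_inv al_q (V_q x)))" using R0(1) by auto
    moreover have "0 \<le> K_inv al_q (V_q x)" by (rule K_inv_nonneg[OF K_functions(5) V_q_nonneg])
    ultimately show ?thesis
      by (simp add: K_inv_nonneg[OF K_functions(3)] K_infinity_nonneg[OF K_functions(4)])
  qed
  interpret periodic_loop f h \<kappa> D V_q U al_w au_w \<alpha>_w \<sigma>_w al_q au_q \<alpha>_q \<sigma>_q \<gamma> R0 T t
    by unfold_locales (use \<open>R0 \<ge> 0\<close> T in auto)
  have S_eq: "S = periodic_loop.S V_q \<alpha>_w \<sigma>_w al_q R0" by (simp add: S S_def)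
  have XS: "X \<subseteq> S"
  proof
    fix x assume "x \<in> X"
    then have "(K_inv \<alpha>_w \<circ> \<sigma>_w \<circ> K_inv al_q \<circ> V_q) x \<le> R0"
      using R0(2) closure_subset by blast
    then show "x \<in> S" unfolding S_eq by (intro in_S_if) simp
  qed
  have "\<exists>r>0. asymptotically_stable_from f h \<kappa> D t (ball 0 r)" if "X \<noteq> {0}"
  proof -
    \<comment> \<open>If R0 were 0, then S, and with it the nonempty X, would be {0}. In that
      excluded case T is unrestricted, which says nothing about states near the origin.\<close>
    have "R0 \<noteq> 0" using XS that X(2) S_eq_zero unfolding S_eq by auto
    then obtain r where "r > 0" "ball 0 r \<subseteq> S"
      using ball_subset_S \<open>R0 \<ge> 0\<close> unfolding S_eq by (metis less_eq_real_def)
    then show ?thesis using asymptotically_stable_from_subset unfolding S_eq by blast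
  qed
  moreover have "asymptotically_stable_from f h \<kappa> D t X"
    using XS unfolding S_eq by (rule asymptotically_stable_from_subset)
  moreover have "positively_invariant f h \<kappa> D t S"
    unfolding positively_invariant_def S_eq using stays_in_S by blast
  moreover have "norm (sampling_error h \<kappa> t x s) \<le> R0"
    if "uncertainty D (t 0) d" "sampled_solution f h \<kappa> t d b x" "x (t 0) \<in> X" "t 0 \<le> s" "ereal s < b"
    for d b x s
    using sampling_error_bound[OF that(1,2) _ that(4,5)] XS that(3) unfolding S_eq by blast
  ultimately show ?thesis using XS by blast
qed

end
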